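(* Let $M$ be a closed surface and let $(M,g_t,V_t)$ be a $C^\infty$ family of Schrödinger data with $g_t\to g_0$ in $C^2$ and $V_t\to V_0$ in $C^0$ as $t\to0$. Let $\varphi_{k,t}$ be an eigenbranch of $H_t=-\Delta_{g_t}+V_t$, with eigenvalues $\lambda_{k,t}\to\lambda_{k,0}$, with $\lambda_{k,0}>0$ and $\varphi_{k,t}\to\varphi_{k,0}$ in $C^\infty(M)$. Then there exist constants $c_*,t_*>0$ (depending on $(M,g_0,V_0)$ and $\varphi_{k,0}$) such that for all $|t|<t_*$ no connected component of $\mathcal N(\varphi_{k,t})$ is entirely contained in a $g_0$-geodesic ball of radius $c_*\lambda_{k,0}^{-1/2}$.
   Context: $M$ is compact, connected, without boundary. $(g_t)$ and $(V_t)$ are families of smooth Riemannian metrics and smooth real potentials on $M$, with $t$ in an open interval around $0$. $-\Delta_{g_t}$ is the positive semidefinite Laplace–Beltrami operator. An eigenbranch is a smooth one-parameter family of real eigenpairs $H_t\varphi_{k,t}=\lambda_{k,t}\varphi_{k,t}$ with $\|\varphi_{k,t}\|_{L^2(M,g_t)}=1$. $\mathcal N(\varphi)=\{x\in M:\varphi(x)=0\}$ is the nodal set.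
   Formalization: The constant t_* may depend on the whole family (g_t, V_t, φ_{k,t}), since a t_* determined by (M,g_0,V_0) and φ_{k,0} alone fails after speeding up the parameter t; c_* still depends only on the data at t=0. *)

theory Defs
  imports "HOL-Analysis.Analysis"
begin

section \<open>Iterated derivatives and smoothness\<close>

text \<open>
  \<open>iter_deriv [v1, ..., vk] f\<close> is the iterated directional derivative of \<open>f\<close> along the
  vectors \<open>v1, ..., vk\<close>.  On an open set \<open>S\<close> (the only case used below) a map is \<open>C\<close>-infinity
  iff all of its iterated directional derivatives are differentiable at every point of \<open>S\<close>.
\<close>

primrec iter_deriv ::
  "'v list \<Rightarrow> ('v::real_normed_vector \<Rightarrow> 'w::real_normed_vector) \<Rightarrow> 'v \<Rightarrow> 'w" where
  "iter_deriv [] f = f"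
| "iter_deriv (v # vs) f = (\<lambda>x. frechet_derivative (iter_deriv vs f) (at x) v)"

definition smooth_on ::
  "'v::real_normed_vector set \<Rightarrow> ('v \<Rightarrow> 'w::real_normed_vector) \<Rightarrow> bool" where
  "smooth_on S f \<longleftrightarrow> (\<forall>vs. \<forall>x\<in>S. iter_deriv vs f differentiable (at x))"


section \<open>Smooth manifolds\<close>

text \<open>
  The underlying space of a manifold is a whole Hausdorff type \<open>'a\<close>; its smooth structure is
  given by an atlas, which need not be maximal.  A chart is a pair of a domain and a
  coordinate map; values of the coordinate map outside the domain are irrelevant.
\<close>

type_synonym ('a, 'n) chart = "'a set \<times> ('a \<Rightarrow> real ^ 'n)"

definition chart_inv :: "('a, 'n) chart \<Rightarrow> real ^ 'n \<Rightarrow> 'a" where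
  "chart_inv c = inv_into (fst c) (snd c)"

definition chart_image :: "('a, 'n) chart \<Rightarrow> (real ^ 'n) set" where
  "chart_image c = snd c ` fst c"

definition is_chart :: "('a::topological_space, 'n::finite) chart \<Rightarrow> bool" where
  "is_chart c \<longleftrightarrow> open (fst c) \<and> open (chart_image c) \<and>
     homeomorphism (fst c) (chart_image c) (snd c) (chart_inv c)"

definition transition :: "('a, 'n) chart \<Rightarrow> ('a, 'n) chart \<Rightarrow> real ^ 'n \<Rightarrow> real ^ 'n" where
  "transition c d = snd d \<circ> chart_inv c"

definition smooth_atlas :: "('a::topological_space, 'n::finite) chart set \<Rightarrow> bool" where
  "smooth_atlas A \<longleftrightarrow>
     (\<forall>c\<in>A. is_chart c) \<and> (\<Union>c\<in>A. fst c) = UNIV \<and>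
     (\<forall>c\<in>A. \<forall>d\<in>A. smooth_on (snd c ` (fst c \<inter> fst d)) (transition c d))"

text \<open>No boundary: charts are homeomorphisms onto open subsets of the full Euclidean space.\<close>

definition closed_manifold :: "('a::t2_space, 'n::finite) chart set \<Rightarrow> bool" where
  "closed_manifold A \<longleftrightarrow>
     smooth_atlas A \<and> compact (UNIV :: 'a set) \<and> connected (UNIV :: 'a set)"


section \<open>Fields, families of fields and their convergence\<close>

text \<open>
  A field assigns to every chart \<open>c\<close> and every point \<open>p\<close> of its domain the component(s) at \<open>p\<close>
  with respect to \<open>c\<close>.  A scalar function \<open>f\<close> is the field \<open>\<lambda>_. f\<close>.
\<close>

definition smooth_field ::
  "('a, 'n::finite) chart set \<Rightarrow> (('a, 'n) chart \<Rightarrow> 'a \<Rightarrow> 'w::real_normed_vector) \<Rightarrow> bool" where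
  "smooth_field A F \<longleftrightarrow> (\<forall>c\<in>A. smooth_on (chart_image c) (F c \<circ> chart_inv c))"

text \<open>Joint smoothness in the parameter and the point.\<close>

definition smooth_field_family ::
  "('a, 'n::finite) chart set \<Rightarrow> real set \<Rightarrow>
   (real \<Rightarrow> ('a, 'n) chart \<Rightarrow> 'a \<Rightarrow> 'w::real_normed_vector) \<Rightarrow> bool" where
  "smooth_field_family A I F \<longleftrightarrow>
     (\<forall>c\<in>A. smooth_on (I \<times> chart_image c) (\<lambda>(t, x). F t c (chart_inv c x)))"

text \<open>
  Convergence \<open>F t \<longrightarrow> F0\<close> in \<open>C^k\<close> as \<open>t \<longrightarrow> 0\<close>: uniform convergence, on compact subsets of
  every chart, of all derivatives of the components of order at most \<open>k\<close>.
\<close>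

definition Ck_tendsto ::
  "('a, 'n::finite) chart set \<Rightarrow> nat \<Rightarrow>
   (real \<Rightarrow> ('a, 'n) chart \<Rightarrow> 'a \<Rightarrow> 'w::real_normed_vector) \<Rightarrow>
   (('a, 'n) chart \<Rightarrow> 'a \<Rightarrow> 'w) \<Rightarrow> bool" where
  "Ck_tendsto A k F F0 \<longleftrightarrow>
     (\<forall>c\<in>A. \<forall>K. compact K \<and> K \<subseteq> chart_image c \<longrightarrow>
        (\<forall>vs. length vs \<le> k \<longrightarrow>
           uniform_limit K (\<lambda>t. iter_deriv vs (F t c \<circ> chart_inv c))
             (iter_deriv vs (F0 c \<circ> chart_inv c)) (at 0)))"


section \<open>Riemannian metrics\<close>

text \<open>
  A metric is given by its coefficient matrices \<open>g c p = (g_ij(p))\<close> in all charts \<open>c\<close>, subject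
  to the transformation law of a covariant 2-tensor.
\<close>

type_synonym ('a, 'n) metric = "('a, 'n) chart \<Rightarrow> 'a \<Rightarrow> real ^ 'n ^ 'n"

definition riemannian_metric ::
  "('a::topological_space, 'n::finite) chart set \<Rightarrow> ('a, 'n) metric \<Rightarrow> bool" where
  "riemannian_metric A g \<longleftrightarrow>
     smooth_field A g \<and>
     (\<forall>c\<in>A. \<forall>p\<in>fst c. transpose (g c p) = g c p \<and> (\<forall>v. v \<noteq> 0 \<longrightarrow> v \<bullet> (g c p *v v) > 0)) \<and>
     (\<forall>c\<in>A. \<forall>d\<in>A. \<forall>p\<in>fst c \<inter> fst d.
        let J = matrix (frechet_derivative (transition c d) (at (snd c p)))
        in g c p = transpose J ** g d p ** J)"

text \<open>
  \<open>curve_of_length A g p q L\<close>: there is a piecewise \<open>C^1\<close> curve of length \<open>L\<close> from \<open>p\<close> to \<open>q\<close>.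
  The curve is a concatenation of pieces, each lying in one chart (every piecewise \<open>C^1\<close> curve
  can be subdivided in this way) and each \<open>C^1\<close> up to its endpoints, so that the integral
  giving its length always exists.
\<close>

definition coord_length ::
  "(real ^ 'n \<Rightarrow> real ^ 'n ^ 'n) \<Rightarrow> (real \<Rightarrow> real ^ 'n::finite) \<Rightarrow> real" where
  "coord_length G u = integral {0..1}
     (\<lambda>s. sqrt (vector_derivative u (at s) \<bullet> (G (u s) *v vector_derivative u (at s))))"

inductive curve_of_length ::
  "('a, 'n::finite) chart set \<Rightarrow> ('a, 'n) metric \<Rightarrow> 'a \<Rightarrow> 'a \<Rightarrow> real \<Rightarrow> bool"
  for A g where
  trivial: "curve_of_length A g p p 0"
| append: "curve_of_length A g p q L \<Longrightarrow> c \<in> A \<Longrightarrow>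
     u C1_differentiable_on {0..1} \<Longrightarrow> u ` {0..1} \<subseteq> chart_image c \<Longrightarrow>
     chart_inv c (u 0) = q \<Longrightarrow> chart_inv c (u 1) = r \<Longrightarrow>
     curve_of_length A g p r (L + coord_length (g c \<circ> chart_inv c) u)"

definition riem_dist ::
  "('a, 'n::finite) chart set \<Rightarrow> ('a, 'n) metric \<Rightarrow> 'a \<Rightarrow> 'a \<Rightarrow> real" where
  "riem_dist A g p q = Inf {L. curve_of_length A g p q L}"

definition geodesic_ball ::
  "('a, 'n::finite) chart set \<Rightarrow> ('a, 'n) metric \<Rightarrow> 'a \<Rightarrow> real \<Rightarrow> 'a set" where
  "geodesic_ball A g p r = {q. riem_dist A g p q < r}"

text \<open>The Borel measure which in every chart has density \<open>sqrt (det g)\<close>.\<close>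

definition riem_volume ::
  "('a::topological_space, 'n::finite) chart set \<Rightarrow> ('a, 'n) metric \<Rightarrow> 'a measure" where
  "riem_volume A g = (THE \<mu>. sets \<mu> = sets borel \<and>
     (\<forall>c\<in>A. \<forall>B\<in>sets borel. B \<subseteq> fst c \<longrightarrow>
        emeasure \<mu> B =
          (\<integral>\<^sup>+x\<in>snd c ` B. ennreal (sqrt (det (g c (chart_inv c x)))) \<partial>lborel)))"

definition L2_norm ::
  "('a::topological_space, 'n::finite) chart set \<Rightarrow> ('a, 'n) metric \<Rightarrow> ('a \<Rightarrow> real) \<Rightarrow> real" where
  "L2_norm A g f = sqrt (\<integral>p. (f p)\<^sup>2 \<partial>riem_volume A g)"


section \<open>The Schroedinger operator\<close>

definition partial_deriv :: "'n::finite \<Rightarrow> (real ^ 'n \<Rightarrow> real) \<Rightarrow> real ^ 'n \<Rightarrow> real" where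
  "partial_deriv i f x = frechet_derivative f (at x) (axis i 1)"

definition coord_laplacian ::
  "(real ^ 'n \<Rightarrow> real ^ 'n ^ 'n) \<Rightarrow> (real ^ 'n::finite \<Rightarrow> real) \<Rightarrow> real ^ 'n \<Rightarrow> real" where
  "coord_laplacian G u x =
     (1 / sqrt (det (G x))) *
     (\<Sum>i\<in>UNIV. partial_deriv i
        (\<lambda>y. sqrt (det (G y)) * (\<Sum>j\<in>UNIV. matrix_inv (G y) $ i $ j * partial_deriv j u y)) x)"

text \<open>
  The Laplace-Beltrami operator (with nonpositive spectrum) and \<open>H = - Delta_g + V\<close>, computed
  at \<open>p\<close> in the chart \<open>c\<close> around \<open>p\<close>.
  The value does not depend on \<open>c\<close> when \<open>g\<close> is a Riemannian metric and \<open>f\<close> is smooth.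
\<close>

definition laplace_beltrami ::
  "('a, 'n::finite) chart \<Rightarrow> ('a, 'n) metric \<Rightarrow> ('a \<Rightarrow> real) \<Rightarrow> 'a \<Rightarrow> real" where
  "laplace_beltrami c g f p = coord_laplacian (g c \<circ> chart_inv c) (f \<circ> chart_inv c) (snd c p)"

definition schroedinger_op ::
  "('a, 'n::finite) chart \<Rightarrow> ('a, 'n) metric \<Rightarrow> ('a \<Rightarrow> real) \<Rightarrow> ('a \<Rightarrow> real) \<Rightarrow> 'a \<Rightarrow> real" where
  "schroedinger_op c g V f p = - laplace_beltrami c g f p + V p * f p"

definition schroedinger_data ::
  "('a::topological_space, 'n::finite) chart set \<Rightarrow> ('a, 'n) metric \<Rightarrow> ('a \<Rightarrow> real) \<Rightarrow> bool" where
  "schroedinger_data A g V \<longleftrightarrow> riemannian_metric A g \<and> smooth_field A (\<lambda>_. V)"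

definition normalized_eigenpair ::
  "('a::topological_space, 'n::finite) chart set \<Rightarrow> ('a, 'n) metric \<Rightarrow> ('a \<Rightarrow> real) \<Rightarrow>
   real \<Rightarrow> ('a \<Rightarrow> real) \<Rightarrow> bool" where
  "normalized_eigenpair A g V l f \<longleftrightarrow>
     smooth_field A (\<lambda>_. f) \<and>
     (\<forall>c\<in>A. \<forall>p\<in>fst c. schroedinger_op c g V f p = l * f p) \<and>
     L2_norm A g f = 1"

definition parameter_interval :: "real set \<Rightarrow> bool" where
  "parameter_interval I \<longleftrightarrow> open I \<and> is_interval I \<and> 0 \<in> I"

definition smooth_schroedinger_family ::
  "('a::topological_space, 'n::finite) chart set \<Rightarrow> real set \<Rightarrow>
   (real \<Rightarrow> ('a, 'n) metric) \<Rightarrow> (real \<Rightarrow> 'a \<Rightarrow> real) \<Rightarrow> bool" where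
  "smooth_schroedinger_family A I g V \<longleftrightarrow>
     (\<forall>t\<in>I. schroedinger_data A (g t) (V t)) \<and>
     smooth_field_family A I g \<and> smooth_field_family A I (\<lambda>t _. V t)"

definition eigenbranch ::
  "('a::topological_space, 'n::finite) chart set \<Rightarrow> real set \<Rightarrow>
   (real \<Rightarrow> ('a, 'n) metric) \<Rightarrow> (real \<Rightarrow> 'a \<Rightarrow> real) \<Rightarrow>
   (real \<Rightarrow> real) \<Rightarrow> (real \<Rightarrow> 'a \<Rightarrow> real) \<Rightarrow> bool" where
  "eigenbranch A I g V lam \<phi> \<longleftrightarrow>
     (\<forall>t\<in>I. normalized_eigenpair A (g t) (V t) (lam t) (\<phi> t)) \<and>
     smooth_on I lam \<and> smooth_field_family A I (\<lambda>t _. \<phi> t)"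

definition nodal_set :: "('a \<Rightarrow> real) \<Rightarrow> 'a set" where
  "nodal_set f = {p. f p = 0}"

end

theory Submission
  imports Defs
begin

text \<open>
  On a small coordinate ball around \<open>x0\<close>, put \<open>q x = |x - x0|\<^sup>2\<close>.  There \<open>\<Delta> q\<close> is bounded
  below by a positive constant, uniformly for metrics \<open>C^1\<close>-close to \<open>g0\<close>, so for suitable \<open>\<kappa>\<close>
  the positive functions \<open>1 - \<kappa> q\<close> and \<open>1 + \<kappa> q\<close> are a strict supersolution and a subsolution of
  \<open>\<Delta> u + (\<lambda> - V) u = 0\<close>, and the equation satisfies a comparison principle.

  Suppose a component \<open>N\<close> of the nodal set lies in the ball.  It is contained in a compact,
  relatively open part \<open>K\<close> of the nodal set.  By comparison the solution vanishes in the bounded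
  complementary components of \<open>K\<close>, so these can be added to \<open>K\<close>.  Then, by Janiszewski's theorem,
  \<open>K\<close> does not separate a connected neighbourhood of \<open>N\<close>; hence the solution has a constant sign
  around \<open>K\<close>, and comparison with a small multiple of \<open>1 + \<kappa> q\<close> keeps it away from \<open>0\<close> on \<open>N\<close>,
  a contradiction.

  A bump function supported in a coordinate ball changes along a curve at most by a constant times
  the length, so small geodesic balls lie in coordinate balls; compactness makes the radius uniform.
\<close>

section \<open>Plane topology\<close>

text \<open>A linear bijection between \<open>real^2\<close> and \<open>complex\<close> is a
  homeomorphism, so Janiszewski's theorem for the complex plane carries over.\<close>

lemma Janiszewski_real2:
  fixes a b :: "real^2"
  assumes "compact S" "closed T" "connected (S \<inter> T)"
    and "connected_component (- S) a b" "connected_component (- T) a b"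
  shows "connected_component (- (S \<union> T)) a b"
proof -
  have "DIM(real^2) = DIM(complex)" by simp
  then obtain f :: "real^2 \<Rightarrow> complex" and g where fg: "linear f" "linear g"
    "\<And>x. g (f x) = x" "\<And>y. f (g y) = y"
    using isomorphisms_UNIV_UNIV by metis
  have contf: "continuous_on X f" for X using fg(1) linear_continuous_on linear_linear by blast
  have contg: "continuous_on X g" for X using fg(2) linear_continuous_on linear_linear by blast
  have im: "f ` X = g -` X" for X
  proof
    show "f ` X \<subseteq> g -` X" using fg by auto
    show "g -` X \<subseteq> f ` X" using fg by (metis image_eqI subsetI vimageE)
  qed
  have cc: "connected_component (f ` X) (f a) (f b)" if "connected_component X a b" for X
    using that contf unfolding connected_component_def by (metis connected_continuous_image image_eqI image_mono)
  have compl: "f ` (- X) = - (f ` X)" for X by (simp add: im vimage_Compl)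
  have "connected_component (- (f ` S \<union> f ` T)) (f a) (f b)"
  proof (rule Janiszewski)
    show "compact (f ` S)" using assms(1) contf compact_continuous_image by blast
    show "closed (f ` T)" unfolding im using assms(2) contg by (simp add: closed_vimage)
    have "f ` S \<inter> f ` T = f ` (S \<inter> T)" by (simp add: im)
    then show "connected (f ` S \<inter> f ` T)"
      using connected_continuous_image[OF contf assms(3)] by simp
    show "connected_component (- (f ` S)) (f a) (f b)" using cc[OF assms(4)] compl by simp
    show "connected_component (- (f ` T)) (f a) (f b)" using cc[OF assms(5)] compl by simp
  qed
  then have "connected_component (f ` (- (S \<union> T))) (f a) (f b)"
    by (simp only: compl image_Un)
  then obtain X where X: "connected X" "X \<subseteq> f ` (- (S \<union> T))" "f a \<in> X" "f b \<in> X"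
    unfolding connected_component_def by auto
  have "connected (g ` X)" using X(1) contg connected_continuous_image by blast
  moreover have "g ` X \<subseteq> - (S \<union> T)" using X(2) fg(3) by auto
  moreover have "a \<in> g ` X" "b \<in> g ` X" using X(3,4) fg(3) by (metis image_eqI)+
  ultimately show ?thesis unfolding connected_component_def by blast
qed

text \<open>Neither the compact set \<open>F \<inter> U\<close> nor the closed set
  \<open>- U\<close> separates two points of \<open>U - F\<close>: the connected set
  \<open>- F\<close> joins them off the first, \<open>U\<close> off the second. The two sets are
  disjoint, so Janiszewski's theorem applies to their union, whose complement is
  \<open>U - F\<close>.\<close>

lemma connected_diff_nonseparating_compact:
  fixes F U :: "(real^2) set"
  assumes "compact F" "connected (- F)" "open U" "connected U" "compact (F \<inter> U)"
  shows "connected (U - F)"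
  unfolding connected_iff_connected_component
proof (intro ballI)
  fix a b assume ab: "a \<in> U - F" "b \<in> U - F"
  have "connected_component (- (F \<inter> U \<union> - U)) a b"
  proof (rule Janiszewski_real2)
    show "compact (F \<inter> U)" "closed (- U)" using assms by (auto simp: closed_Compl)
    have e: "F \<inter> U \<inter> - U = {}" by auto
    show "connected (F \<inter> U \<inter> - U)" unfolding e by simp
    show "connected_component (- (F \<inter> U)) a b"
      unfolding connected_component_def using assms(2) ab by (intro exI[of _ "- F"]) auto
    show "connected_component (- (- U)) a b"
      unfolding connected_component_def using assms(4) ab by (intro exI[of _ "U"]) auto
  qed
  moreover have "- (F \<inter> U \<union> - U) = U - F" by auto
  ultimately show "connected_component (U - F) a b" by simp
qed

text \<open>The equation enters only through \<open>zero\<close>, \<open>pos\<close> and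
  \<open>neg\<close>, three consequences of the comparison principle; the rest is plane
  topology.\<close>

lemma no_compact_nodal_component:
  fixes u :: "real^2 \<Rightarrow> real" and D :: "(real^2) set"
  assumes D: "open D" "convex D" and cont: "continuous_on D u"
    and zero: "\<And>W. \<lbrakk>open W; bounded W; closure W \<subseteq> D; \<forall>x\<in>frontier W. u x = 0\<rbrakk> \<Longrightarrow> \<forall>x\<in>W. u x = 0"
    and pos: "\<And>W. \<lbrakk>open W; bounded W; closure W \<subseteq> D; \<forall>x\<in>frontier W. u x > 0\<rbrakk> \<Longrightarrow> \<forall>x\<in>W. u x > 0"
    and neg: "\<And>W. \<lbrakk>open W; bounded W; closure W \<subseteq> D; \<forall>x\<in>frontier W. u x < 0\<rbrakk> \<Longrightarrow> \<forall>x\<in>W. u x < 0"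
    and N: "N \<in> components {x \<in> D. u x = 0}"
  shows "\<not> compact N"
proof
  assume cN: "compact N"
  define Z where "Z = {x \<in> D. u x = 0}"
  have Zcl: "closedin (top_of_set D) Z"
    unfolding Z_def using continuous_closedin_preimage_constant[OF cont] by simp
  have lcZ: "locally compact Z"
    using Zcl D(1) locally_compact_closedin open_imp_locally_compact by blast
  have NZ: "N \<in> components Z" using N by (simp add: Z_def)
  have ND: "N \<subseteq> D" using in_components_subset[OF NZ] by (auto simp: Z_def)
  \<comment> \<open>Other components may accumulate at \<open>N\<close>, so \<open>N\<close> need
    not be relatively open in \<open>Z\<close>. By the Sura-Bura theorem a compact component of a
    locally compact space still has small neighbourhoods that are both compact and relatively
    open.\<close>
  obtain K where K: "openin (top_of_set Z) K" "compact K" "N \<subseteq> K" "K \<subseteq> D"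
    by (rule Sura_Bura_clopen_subset[OF lcZ NZ cN D(1) ND])
  obtain T where T: "open T" "K = Z \<inter> T" using K(1) openin_open by metis
  have KZ: "K \<subseteq> Z" using T by auto
  \<comment> \<open>Filling the holes of \<open>K\<close> makes the complement connected, and
    \<open>zero\<close> keeps the filled set inside \<open>Z\<close>.\<close>
  define F where "F = K \<union> inside K"
  have clK: "closed K" using K(2) compact_imp_closed by blast
  have insD: "inside K \<subseteq> D" using inside_mono[OF K(4)] inside_convex[OF D(2)] by auto
  have "\<forall>x\<in>inside K. u x = 0"
  proof (rule zero)
    show "open (inside K)" using open_inside clK by blast
    show "bounded (inside K)" using bounded_inside K(2) compact_imp_bounded by blast
    show "closure (inside K) \<subseteq> D" using closure_inside_subset[OF clK] insD K(4) by blast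
    show "\<forall>x\<in>frontier (inside K). u x = 0"
      using frontier_inside_subset[OF clK] KZ by (auto simp: Z_def)
  qed
  then have FZ: "F \<subseteq> Z" using KZ insD by (auto simp: F_def Z_def)
  have F_out: "F = - outside K" unfolding F_def by (rule union_with_inside)
  have "closed F" unfolding F_out using open_outside[OF clK] by (simp add: closed_Compl)
  moreover have "bounded F"
    unfolding F_def using bounded_inside K(2) compact_imp_bounded by auto
  ultimately have cF: "compact F" using compact_eq_bounded_closed by blast
  have conF: "connected (- F)" unfolding F_out
    using connected_outside[OF compact_imp_bounded[OF K(2)]] by simp
  \<comment> \<open>An open set that meets \<open>Z\<close> exactly in \<open>F\<close>:
    \<open>T\<close> cuts \<open>K\<close> out of \<open>Z\<close>, and the holes, which are open
    and contained in \<open>Z\<close>, are adjoined.\<close>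
  define T' where "T' = D \<inter> (T \<union> inside K)"
  have oT': "open T'" unfolding T'_def using D(1) T(1) open_inside[OF clK] by auto
  have ZT': "Z \<inter> T' = F" using FZ T(2) insD by (auto simp: T'_def F_def Z_def)
  obtain x where x: "x \<in> N" using in_components_nonempty[OF NZ] by auto
  have xF: "x \<in> F" using x K(3) by (auto simp: F_def)
  then have xT': "x \<in> T'" using ZT' by auto
  \<comment> \<open>\<open>T'\<close> may be disconnected, while the separation lemma needs a
    connected open set, so only the component around one point \<open>x\<close> of \<open>N\<close>
    is kept.\<close>
  define W where "W = connected_component_set T' x"
  have oW: "open W" unfolding W_def using open_connected_component oT' by blast
  have WT': "W \<subseteq> T'" unfolding W_def by (rule connected_component_subset)
  have conW: "connected W" unfolding W_def by (rule connected_connected_component)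
  have xW: "x \<in> W" unfolding W_def using xT' by simp
  have oW': "open (T' - W)"
    unfolding W_def complement_connected_component_unions
    using open_connected_component[OF oT'] by auto
  \<comment> \<open>\<open>F\<close> lies in \<open>T'\<close>, so intersecting it with
    \<open>W\<close> amounts to removing the other components of \<open>T'\<close>. These form an
    open set, hence compactness survives.\<close>
  have "F \<inter> W = F - (T' - W)" using ZT' WT' by auto
  then have cFW: "compact (F \<inter> W)" using cF oW' by (simp add: compact_diff)
  have conWF: "connected (W - F)"
    by (rule connected_diff_nonseparating_compact) (use cF conF oW conW cFW in auto)
  have unz: "u y \<noteq> 0" if "y \<in> W - F" for y
    using that ZT' WT' by (auto simp: Z_def T'_def)
  have "F \<inter> W \<subseteq> W" by auto
  obtain W' where W': "open W'" "bounded W'" "F \<inter> W \<subseteq> W'" "closure W' \<subseteq> W"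
  proof -
    have "F \<inter> W \<inter> - W = {}" by auto
    then obtain V1 V2 where V: "open V1" "open V2" "F \<inter> W \<subseteq> V1" "- W \<subseteq> V2" "V1 \<inter> V2 = {}"
      by (rule separation_normal[OF compact_imp_closed[OF cFW] closed_Compl[OF oW]])
    obtain r where r: "F \<inter> W \<subseteq> ball 0 r"
      using cFW compact_imp_bounded bounded_subset_ballD by blast
    have "closure V1 \<subseteq> - V2" using V by (intro closure_minimal) (auto simp: closed_Compl)
    then have "closure (V1 \<inter> ball 0 r) \<subseteq> W" using V(4) closure_mono[of "V1 \<inter> ball 0 r" V1] by auto
    then show ?thesis using V(1,3) r by (intro that[of "V1 \<inter> ball 0 r"]) (auto simp: bounded_Int)
  qed
  have clD: "closure W' \<subseteq> D" using W'(4) WT' by (auto simp: T'_def)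
  have xW': "x \<in> W'" using W'(3) xF xW by auto
  have ux: "u x = 0" using xF FZ by (auto simp: Z_def)
  \<comment> \<open>The frontier of \<open>W'\<close> avoids \<open>F\<close>, which contains all
    zeros of \<open>u\<close> in \<open>T'\<close>. There \<open>u\<close> will turn out to have one
    strict sign, although \<open>u x = 0\<close> at the point \<open>x\<close> of
    \<open>W'\<close>.\<close>
  have fr: "frontier W' \<subseteq> W - F" using W' by (auto simp: frontier_def interior_open)
  have "connected (u ` (W - F))"
    by (rule connected_continuous_image[OF _ conWF])
      (rule continuous_on_subset[OF cont], use WT' in \<open>auto simp: T'_def\<close>)
  note ivl = connectedD_interval[OF this]
  have "0 \<notin> u ` (W - F)" using unz by auto
  then have "\<not> (u y \<le> 0 \<and> 0 \<le> u z)" if "y \<in> W - F" "z \<in> W - F" for y z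
    using ivl[of "u y" "u z" 0] that by blast
  then have "(\<forall>y\<in>W - F. u y > 0) \<or> (\<forall>y\<in>W - F. u y < 0)"
    by (meson linorder_not_less)
  then show False
  proof
    assume "\<forall>y\<in>W - F. u y > 0"
    then have "\<forall>y\<in>W'. u y > 0" using pos[OF W'(1,2) clD] fr by blast
    then show False using xW' ux by auto
  next
    assume "\<forall>y\<in>W - F. u y < 0"
    then have "\<forall>y\<in>W'. u y < 0" using neg[OF W'(1,2) clD] fr by blast
    then show False using xW' ux by auto
  qed
qed

section \<open>Second order conditions and the Laplacian in two dimensions\<close>

lemma smooth_on_differentiable:
  assumes "smooth_on S f" "x \<in> S" shows "f differentiable (at x)"
  using assms unfolding smooth_on_def by (metis iter_deriv.simps(1))

lemma smooth_on_frechet_derivative_differentiable: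
  assumes "smooth_on S f" "x \<in> S"
  shows "(\<lambda>y. frechet_derivative f (at y) v) differentiable (at x)"
proof -
  have "iter_deriv [v] f differentiable (at x)" using assms unfolding smooth_on_def by blast
  then show ?thesis by simp
qed

text \<open>No second order Taylor formula is involved: if \<open>D v\<close> were negative, the
  derivative of \<open>f\<close> along the line through \<open>x\<close> in direction
  \<open>v\<close>, which is zero at \<open>x\<close>, would be negative just after
  \<open>x\<close>, and the mean value theorem would give a value below \<open>f x\<close>.\<close>

lemma local_min_second_derivative:
  fixes f :: "'a::real_normed_vector \<Rightarrow> real"
  assumes S: "open S" "x \<in> S" and f': "\<And>y. y \<in> S \<Longrightarrow> (f has_derivative f' y) (at y)"
    and D: "((\<lambda>y. f' y v) has_derivative D) (at x)"
    and min: "\<And>y. y \<in> S \<Longrightarrow> f x \<le> f y"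
  shows "f' x v = 0" "D v \<ge> 0"
proof -
  have f'0: "f' x = (\<lambda>v. 0)"
    by (rule differential_zero_maxmin[OF S(2,1) f'[OF S(2)]]) (use min in auto)
  then show fv: "f' x v = 0" by simp
  define k where "k = (\<lambda>\<tau>. f' (x + \<tau> *\<^sub>R v) v)"
  have line: "((\<lambda>\<tau>. x + \<tau> *\<^sub>R v) has_derivative (\<lambda>h. h *\<^sub>R v)) (at \<tau>)" for \<tau> :: real
    by (auto intro!: derivative_eq_intros)
  have "(k has_derivative (\<lambda>h. D (h *\<^sub>R v))) (at 0)"
    unfolding k_def by (rule has_derivative_compose[OF line]) (simp add: D)
  moreover have "D (h *\<^sub>R v) = h * D v" for h
    using linear_cmul[OF has_derivative_linear[OF D], of h v] by simp
  ultimately have k: "DERIV k 0 :> D v"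
    by (intro has_derivative_imp_has_field_derivative) auto
  show "D v \<ge> 0"
  proof (rule ccontr)
    assume "\<not> D v \<ge> 0"
    then obtain d where d: "d > 0" "\<And>h. 0 < h \<Longrightarrow> h < d \<Longrightarrow> k h < k 0"
      using DERIV_neg_dec_right[OF k] by auto
    have "((\<lambda>\<tau>. x + \<tau> *\<^sub>R v) \<longlongrightarrow> x + 0 *\<^sub>R v) (at (0::real))" by (intro tendsto_intros)
    then have "eventually (\<lambda>\<tau>. x + \<tau> *\<^sub>R v \<in> S) (at (0::real))"
      by (rule topological_tendstoD[OF _ S(1)]) (use S(2) in simp)
    then obtain e where e: "e > 0" "\<And>\<tau>. \<tau> \<noteq> 0 \<Longrightarrow> \<bar>\<tau>\<bar> < e \<Longrightarrow> x + \<tau> *\<^sub>R v \<in> S"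
      unfolding eventually_at dist_real_def by auto
    define b where "b = min d e / 2"
    have b: "0 < b" "b < d" "b < e" using d(1) e(1) by (auto simp: b_def)
    have inS: "x + \<tau> *\<^sub>R v \<in> S" if "0 \<le> \<tau>" "\<tau> \<le> b" for \<tau>
      using e(2)[of \<tau>] S(2) that b by (cases "\<tau> = 0") auto
    have der: "DERIV (\<lambda>\<tau>. f (x + \<tau> *\<^sub>R v)) \<tau> :> k \<tau>" if "0 \<le> \<tau>" "\<tau> \<le> b" for \<tau>
    proof -
      have d1: "(f has_derivative f' (x + \<tau> *\<^sub>R v)) (at (x + \<tau> *\<^sub>R v))" by (rule f'[OF inS[OF that]])
      have "((\<lambda>\<tau>. f (x + \<tau> *\<^sub>R v)) has_derivative (\<lambda>h. f' (x + \<tau> *\<^sub>R v) (h *\<^sub>R v))) (at \<tau>)"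
        by (rule has_derivative_compose[OF line d1])
      moreover have "f' (x + \<tau> *\<^sub>R v) (h *\<^sub>R v) = h * k \<tau>" for h
        using linear_cmul[OF has_derivative_linear[OF d1], of h v] by (simp add: k_def)
      ultimately show ?thesis by (intro has_derivative_imp_has_field_derivative) auto
    qed
    obtain z where z: "0 < z" "z < b" "f (x + b *\<^sub>R v) - f (x + 0 *\<^sub>R v) = (b - 0) * k z"
      using MVT2[OF b(1) der] by blast
    have "k z < 0" using d(2)[of z] z b fv by (simp add: k_def)
    then have "(b - 0) * k z < 0" using b by (simp add: mult_pos_neg)
    then have "f (x + b *\<^sub>R v) < f x" using z(3) by simp
    then show False using min[OF inS[of b]] b by simp
  qed
qed

text \<open>The product rule splits the divergence form into a first order part, which vanishes at
  critical points of \<open>u\<close>, and a contraction of the second derivatives.\<close>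

lemma coord_laplacian_expand:
  fixes G :: "real ^ 'n \<Rightarrow> real ^ 'n ^ 'n::finite"
  assumes "\<And>i j. (\<lambda>y. sqrt (det (G y)) * matrix_inv (G y) $ i $ j) differentiable (at x)"
    and "\<And>j. partial_deriv j u differentiable (at x)"
  shows "coord_laplacian G u x = 1 / sqrt (det (G x)) * (\<Sum>i\<in>UNIV. \<Sum>j\<in>UNIV.
     partial_deriv i (\<lambda>y. sqrt (det (G y)) * matrix_inv (G y) $ i $ j) x * partial_deriv j u x
     + sqrt (det (G x)) * matrix_inv (G x) $ i $ j * partial_deriv i (partial_deriv j u) x)"
proof -
  define M where "M = (\<lambda>i j y. sqrt (det (G y)) * matrix_inv (G y) $ i $ j)"
  have M: "(M i j has_derivative frechet_derivative (M i j) (at x)) (at x)" for i j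
    using assms(1) frechet_derivative_works unfolding M_def by blast
  have P: "(partial_deriv j u has_derivative frechet_derivative (partial_deriv j u) (at x)) (at x)" for j
    using assms(2) frechet_derivative_works by blast
  have "partial_deriv i (\<lambda>y. \<Sum>j\<in>UNIV. M i j y * partial_deriv j u y) x
      = (\<Sum>j\<in>UNIV. partial_deriv i (M i j) x * partial_deriv j u x
           + M i j x * partial_deriv i (partial_deriv j u) x)" for i
  proof -
    have "((\<lambda>y. \<Sum>j\<in>UNIV. M i j y * partial_deriv j u y) has_derivative
       (\<lambda>h. \<Sum>j\<in>UNIV. M i j x * frechet_derivative (partial_deriv j u) (at x) h
          + frechet_derivative (M i j) (at x) h * partial_deriv j u x)) (at x)"
      by (intro has_derivative_sum has_derivative_mult M P)
    from frechet_derivative_at[OF this, symmetric] show ?thesis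
      by (simp add: partial_deriv_def add.commute)
  qed
  then show ?thesis
    unfolding coord_laplacian_def M_def by (simp add: sum_distrib_left mult.assoc)
qed

section \<open>Matrices of size two: adjugate, inverse and determinant\<close>

definition adj2 :: "real^2^2 \<Rightarrow> real^2^2" where
  "adj2 P = vector [vector [P$2$2, - P$1$2], vector [- P$2$1, P$1$1]]"

lemma adj2_nth [simp]:
  "adj2 P $ 1 $ 1 = P$2$2" "adj2 P $ 1 $ 2 = - P$1$2" "adj2 P $ 2 $ 1 = - P$2$1" "adj2 P $ 2 $ 2 = P$1$1"
  by (simp_all add: adj2_def)

lemma matrix_inv_adj2:
  fixes P :: "real^2^2"
  assumes "det P \<noteq> 0"
  shows "matrix_inv P $ i $ j = adj2 P $ i $ j / det P"
proof -
  define Q where "Q = (1 / det P) *\<^sub>R adj2 P"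
  have Q: "Q $ i $ j = adj2 P $ i $ j / det P" for i j by (simp add: Q_def)
  have PQ: "P ** Q = mat 1"
    unfolding vec_eq_iff forall_2 matrix_matrix_mult_def mat_def sum_2
    using assms by (simp add: Q divide_simps) (simp add: det_2 algebra_simps)
  then have QP: "Q ** P = mat 1" using matrix_left_right_inverse by blast
  \<comment> \<open>\<open>matrix_inv\<close> is defined by choice, so the explicit inverse
    \<open>Q\<close> serves as the witness that the choice succeeds.\<close>
  have "P ** matrix_inv P = mat 1 \<and> matrix_inv P ** P = mat 1"
    unfolding matrix_inv_def by (rule someI[of _ Q]) (use PQ QP in simp)
  then have "matrix_inv P ** (P ** Q) = Q" by (simp add: matrix_mul_assoc)
  then have "matrix_inv P = Q" by (simp add: PQ)
  then show ?thesis by (simp add: Q)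
qed

lemma sqrt_det_matrix_inv:
  fixes P :: "real^2^2"
  assumes "det P > 0"
  shows "sqrt (det P) * matrix_inv P $ i $ j = adj2 P $ i $ j / sqrt (det P)"
  proof -
  have "sqrt (det P) * (adj2 P $ i $ j / det P) = adj2 P $ i $ j / (det P / sqrt (det P))" by simp
  also have "det P / sqrt (det P) = sqrt (det P)" using assms by (intro real_div_sqrt) simp
  finally show ?thesis using assms by (simp add: matrix_inv_adj2)
qed

lemma pos_def_2:
  fixes P :: "real^2^2"
  assumes "transpose P = P" and "\<And>v. v \<noteq> 0 \<Longrightarrow> v \<bullet> (P *v v) > 0"
  shows "P$2$1 = P$1$2" "P$1$1 > 0" "P$2$2 > 0" "det P > 0"
proof -
  show sym: "P$2$1 = P$1$2" by (subst assms(1)[symmetric]) (simp add: transpose_def)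
  have e: "v \<bullet> (P *v v) = v$1 * (P$1$1 * v$1 + P$1$2 * v$2) + v$2 * (P$2$1 * v$1 + P$2$2 * v$2)" for v
    by (simp add: inner_vec_def sum_2 matrix_vector_mult_def)
  have "(vector [1, 0] :: real^2) \<noteq> 0" "(vector [0, 1] :: real^2) \<noteq> 0"
    by (simp_all add: vec_eq_iff forall_2)
  from this[THEN assms(2)] show p: "P$1$1 > 0" "P$2$2 > 0" by (simp_all add: e)
  \<comment> \<open>At this vector the quadratic form takes the value
    \<open>P$1$1 * det P\<close>.\<close>
  have "(vector [- P$1$2, P$1$1] :: real^2) \<noteq> 0" using p by (simp add: vec_eq_iff forall_2)
  from assms(2)[OF this] have "P$1$1 * (P$1$1 * P$2$2 - P$1$2 * P$2$1) > 0"
    by (simp add: e sym algebra_simps)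
  then show "det P > 0" using p by (simp add: det_2 zero_less_mult_iff)
qed

text \<open>The derivative of \<open>det\<close> at \<open>P\<close> in the direction
  \<open>Q\<close>.\<close>

definition det_deriv :: "real^2^2 \<Rightarrow> real^2^2 \<Rightarrow> real" where
  "det_deriv P Q = Q$1$1 * P$2$2 + P$1$1 * Q$2$2 - Q$1$2 * P$2$1 - P$1$2 * Q$2$1"

text \<open>The derivative at \<open>P\<close> in the direction \<open>Q\<close> of an entry of the
  adjugate divided by the root of the determinant, by the quotient rule; \<open>adj2\<close> is
  linear, whence \<open>adj2 Q\<close>. For a metric this quotient is the coefficient matrix under
  the outer derivative in the Laplacian.\<close>

definition adj_deriv :: "real^2^2 \<Rightarrow> real^2^2 \<Rightarrow> 2 \<Rightarrow> 2 \<Rightarrow> real" where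
  "adj_deriv P Q i j =
     adj2 Q $ i $ j / sqrt (det P) - adj2 P $ i $ j * det_deriv P Q / (2 * det P * sqrt (det P))"

lemma has_derivative_vec_nth2:
  fixes G :: "'b::real_normed_vector \<Rightarrow> real ^ 'm ^ 'n"
  assumes "(G has_derivative G') F"
  shows "((\<lambda>y. G y $ i $ j) has_derivative (\<lambda>v. G' v $ i $ j)) F"
  by (intro bounded_linear.has_derivative[OF bounded_linear_vec_nth] assms)

lemma has_derivative_adj2:
  fixes G :: "real^2 \<Rightarrow> real^2^2"
  assumes G: "(G has_derivative G') (at x)" and pos: "det (G x) > 0"
  shows "((\<lambda>y. adj2 (G y) $ i $ j / sqrt (det (G y))) has_derivative (\<lambda>v. adj_deriv (G x) (G' v) i j)) (at x)"
proof -
  note c = has_derivative_vec_nth2[OF G]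
  have a: "((\<lambda>y. adj2 (G y) $ i $ j) has_derivative (\<lambda>v. adj2 (G' v) $ i $ j)) (at x)"
    using exhaust_2[of i] exhaust_2[of j] by (auto intro!: has_derivative_minus c)
  have d: "((\<lambda>y. det (G y)) has_derivative (\<lambda>v. det_deriv (G x) (G' v))) (at x)"
    unfolding det_2
    by (rule has_derivative_eq_rhs[OF has_derivative_diff[OF has_derivative_mult[OF c c] has_derivative_mult[OF c c]]])
      (simp add: det_deriv_def algebra_simps)
  have s: "((\<lambda>y. sqrt (det (G y))) has_derivative (\<lambda>v. det_deriv (G x) (G' v) * (inverse (sqrt (det (G x))) / 2))) (at x)"
    by (rule has_derivative_eq_rhs[OF has_derivative_real_sqrt[OF pos d]]) auto
  define r where "r = sqrt (det (G x))"
  have r: "r \<noteq> 0" and rr: "det (G x) = r * r" using pos by (auto simp: r_def)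
  have alg: "(p * r - q * (d * (inverse r / 2))) / (r * r) = p / r - q * d / (2 * (r * r) * r)" for p q d
    using r by (simp add: divide_simps)
  show ?thesis
    by (rule has_derivative_eq_rhs[OF has_derivative_divide'[OF a s]])
      (use r in \<open>simp_all only: fun_eq_iff adj_deriv_def r_def[symmetric] alg, simp_all add: rr\<close>)
qed

text \<open>The value at \<open>x\<close> of the Laplacian of \<open>y \<mapsto> |y - x0|\<^sup>2\<close>, in terms of the metric \<open>P\<close>,
  its first partial derivatives \<open>Q1, Q2\<close>, and \<open>d = x - x0\<close>.\<close>

definition laplacian_sq_dist :: "real^2^2 \<Rightarrow> real^2^2 \<Rightarrow> real^2^2 \<Rightarrow> real^2 \<Rightarrow> real" where
  "laplacian_sq_dist P Q1 Q2 d =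
     2 * ((adj_deriv P Q1 1 1 + adj_deriv P Q2 2 1) * d$1 + (adj_deriv P Q1 1 2 + adj_deriv P Q2 2 2) * d$2)
       / sqrt (det P) + 2 * (P$1$1 + P$2$2) / det P"

section \<open>The Laplacian of the squared coordinate distance\<close>

lemma partial_deriv_sq_dist:
  fixes x0 :: "real^'n::finite"
  shows "partial_deriv j (\<lambda>y. (y - x0) \<bullet> (y - x0)) = (\<lambda>y. 2 * (y $ j - x0 $ j))"
proof
  fix y :: "real^'n"
  have "((\<lambda>y. (y - x0) \<bullet> (y - x0)) has_derivative (\<lambda>v. 2 * ((y - x0) \<bullet> v))) (at y)"
    by (auto intro!: derivative_eq_intros simp: inner_commute)
  from frechet_derivative_at[OF this, symmetric]
  show "partial_deriv j (\<lambda>y. (y - x0) \<bullet> (y - x0)) y = 2 * (y $ j - x0 $ j)"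
    by (simp add: partial_deriv_def inner_axis)
qed

lemma has_derivative_coord:
  "((\<lambda>y. 2 * (y $ j - x0 $ j)) has_derivative (\<lambda>v. 2 * v $ j)) (at (x :: real^'n::finite))"
  using bounded_linear.has_derivative[OF bounded_linear_vec_nth has_derivative_ident, of j "at x"]
  by (auto intro!: derivative_eq_intros)

lemma partial_deriv_coord:
  "partial_deriv i (\<lambda>y. 2 * (y $ j - x0 $ j)) (x :: real^'n::finite) = (if i = j then 2 else 0)"
  using frechet_derivative_at[OF has_derivative_coord, symmetric, of j x0 x]
  by (simp add: partial_deriv_def axis_def)

text \<open>Positivity of the determinant is asked for on a neighbourhood of \<open>x\<close>,
  because the adjugate formula for the inverse is substituted under a derivative.\<close>

lemma coord_laplacian_2:
  fixes G :: "real^2 \<Rightarrow> real^2^2"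
  assumes S: "open S" "x \<in> S" and pos: "\<And>y. y \<in> S \<Longrightarrow> det (G y) > 0"
    and G: "(G has_derivative G') (at x)"
    and u: "\<And>j. partial_deriv j u differentiable (at x)"
  shows "coord_laplacian G u x = 1 / sqrt (det (G x)) * (\<Sum>i\<in>UNIV. \<Sum>j\<in>UNIV.
     adj_deriv (G x) (G' (axis i 1)) i j * partial_deriv j u x
     + adj2 (G x) $ i $ j / sqrt (det (G x)) * partial_deriv i (partial_deriv j u) x)"
proof -
  have M: "((\<lambda>y. sqrt (det (G y)) * matrix_inv (G y) $ i $ j) has_derivative
     (\<lambda>v. adj_deriv (G x) (G' v) i j)) (at x)" for i j
    by (rule has_derivative_transform_within_open[OF has_derivative_adj2[OF G pos[OF S(2)]] S])
      (simp add: sqrt_det_matrix_inv pos)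
  have pd: "partial_deriv i (\<lambda>y. sqrt (det (G y)) * matrix_inv (G y) $ i $ j) x
      = adj_deriv (G x) (G' (axis i 1)) i j" for i j
    unfolding partial_deriv_def by (simp add: frechet_derivative_at[OF M, symmetric])
  have "(\<lambda>y. sqrt (det (G y)) * matrix_inv (G y) $ i $ j) differentiable (at x)" for i j
    using M differentiable_def by blast
  from coord_laplacian_expand[OF this u] show ?thesis
    by (simp add: pd sqrt_det_matrix_inv pos S(2) del: times_divide_eq_left)
qed

lemma coord_laplacian_sq_dist:
  fixes G :: "real^2 \<Rightarrow> real^2^2"
  assumes S: "open S" "x \<in> S" and pos: "\<And>y. y \<in> S \<Longrightarrow> det (G y) > 0"
    and G: "G differentiable (at x)"
  shows "coord_laplacian G (\<lambda>y. (y - x0) \<bullet> (y - x0)) x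
    = laplacian_sq_dist (G x) (frechet_derivative G (at x) (axis 1 1))
        (frechet_derivative G (at x) (axis 2 1)) (x - x0)"
proof -
  have G': "(G has_derivative frechet_derivative G (at x)) (at x)"
    using G frechet_derivative_works by blast
  have d: "partial_deriv j (\<lambda>y. (y - x0) \<bullet> (y - x0)) differentiable (at x)" for j
    unfolding partial_deriv_sq_dist using has_derivative_coord differentiable_def by blast
  define s where "s = sqrt (det (G x))"
  have s: "s \<noteq> 0" and ss: "det (G x) = s * s"
    using pos[OF S(2)] by (auto simp: s_def)
  have alg: "1 / s * (a * (2 * d1) + p / s * 2 + b * (2 * d2) + (c * (2 * d1) + (d * (2 * d2) + q / s * 2)))
     = 2 * ((a + c) * d1 + (b + d) * d2) / s + 2 * (q + p) / (s * s)" for a b c d p q d1 d2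
    using s by (simp add: divide_simps) (simp add: algebra_simps)
  let ?a = "\<lambda>k. adj_deriv (G x) (frechet_derivative G (at x) (axis k 1))"
  let ?d1 = "x $ 1 - x0 $ 1" and ?d2 = "x $ 2 - x0 $ 2"
  have "coord_laplacian G (\<lambda>y. (y - x0) \<bullet> (y - x0)) x
    = 1 / s * (?a 1 1 1 * (2 * ?d1) + G x $ 2 $ 2 / s * 2 + ?a 1 1 2 * (2 * ?d2)
        + (?a 2 2 1 * (2 * ?d1) + (?a 2 2 2 * (2 * ?d2) + G x $ 1 $ 1 / s * 2)))"
    by (rule trans[OF coord_laplacian_2[OF S pos G' d]], assumption,
      unfold sum_2 partial_deriv_sq_dist partial_deriv_coord s_def[symmetric]) simp
  then show ?thesis unfolding alg laplacian_sq_dist_def s_def[symmetric] by (simp add: ss)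
qed

text \<open>At \<open>d = 0\<close> the first order part disappears and a positive value
  \<open>2 * \<theta>\<close> remains. The expression is continuous in its four arguments, so it
  exceeds \<open>\<theta>\<close> nearby. Thus one bound serves all points near the centre and all
  metrics that are close there together with their first derivatives.\<close>

lemma laplacian_sq_dist_pos_nhds:
  fixes P :: "real^2^2"
  assumes "det P > 0" "P$1$1 + P$2$2 > 0"
  obtains e \<theta> where "e > 0" "\<theta> > 0"
    "\<And>P' Q1' Q2' d. \<lbrakk>norm (P' - P) < e; norm (Q1' - Q1) < e; norm (Q2' - Q2) < e; norm d < e\<rbrakk>
        \<Longrightarrow> \<theta> < laplacian_sq_dist P' Q1' Q2' d"
proof -
  define \<theta> where "\<theta> = (P$1$1 + P$2$2) / det P"
  have th: "\<theta> > 0" using assms by (simp add: \<theta>_def)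
  define F where "F = nhds P \<times>\<^sub>F nhds Q1 \<times>\<^sub>F nhds Q2 \<times>\<^sub>F nhds (0::real^2)"
  have f1: "filterlim fst (nhds P) F" unfolding F_def by (rule filterlim_fst)
  have f2: "filterlim (\<lambda>z. fst (snd z)) (nhds Q1) F" unfolding F_def
    by (rule filterlim_compose[OF filterlim_fst filterlim_snd])
  have f3: "filterlim (\<lambda>z. fst (snd (snd z))) (nhds Q2) F" unfolding F_def
    by (rule filterlim_compose[OF filterlim_fst filterlim_compose[OF filterlim_snd filterlim_snd]])
  have f4: "filterlim (\<lambda>z. snd (snd (snd z))) (nhds 0) F" unfolding F_def
    by (rule filterlim_compose[OF filterlim_snd filterlim_compose[OF filterlim_snd filterlim_snd]])
  have n: "((\<lambda>z. f z $ i $ j) \<longlongrightarrow> L $ i $ j) F" if "(f \<longlongrightarrow> L) F" for f :: "_ \<Rightarrow> real^2^2" and L i j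
    by (intro tendsto_vec_nth that)
  have a: "((\<lambda>z. adj2 (f z) $ i $ j) \<longlongrightarrow> adj2 L $ i $ j) F" if "(f \<longlongrightarrow> L) F" for f :: "_ \<Rightarrow> real^2^2" and L i j
    using exhaust_2[of i] exhaust_2[of j] by (elim disjE; simp) (intro tendsto_minus n that)+
  have det: "((\<lambda>z. det (fst z)) \<longlongrightarrow> det P) F"
    unfolding det_2 by (intro tendsto_intros n f1)
  have ad: "((\<lambda>z. adj_deriv (fst z) (f z) i j) \<longlongrightarrow> adj_deriv P L i j) F"
    if "(f \<longlongrightarrow> L) F" for f L i j
    unfolding adj_deriv_def det_deriv_def
    by (intro tendsto_intros n a det f1 that) (use assms in auto)
  have "((\<lambda>z. laplacian_sq_dist (fst z) (fst (snd z)) (fst (snd (snd z))) (snd (snd (snd z))))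
      \<longlongrightarrow> laplacian_sq_dist P Q1 Q2 0) F"
    unfolding laplacian_sq_dist_def
    by (intro tendsto_intros n ad det f1 f2 f3 f4 tendsto_vec_nth) (use assms in auto)
  moreover have "\<theta> < laplacian_sq_dist P Q1 Q2 0"
  proof -
    have "laplacian_sq_dist P Q1 Q2 0 = 2 * \<theta>" by (simp add: laplacian_sq_dist_def \<theta>_def)
    then show ?thesis using th by simp
  qed
  ultimately have "eventually (\<lambda>z. \<theta> < laplacian_sq_dist (fst z) (fst (snd z)) (fst (snd (snd z))) (snd (snd (snd z)))) F"
    by (rule order_tendstoD)
  then have "eventually (\<lambda>z. \<theta> < laplacian_sq_dist (fst z) (fst (snd z)) (fst (snd (snd z))) (snd (snd (snd z)))) (nhds (P, Q1, Q2, 0))"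
    unfolding F_def nhds_prod .
  then obtain \<epsilon> where \<epsilon>: "\<epsilon> > 0" "\<And>z. dist z (P, Q1, Q2, 0) < \<epsilon> \<Longrightarrow>
      \<theta> < laplacian_sq_dist (fst z) (fst (snd z)) (fst (snd (snd z))) (snd (snd (snd z)))"
    unfolding eventually_nhds_metric by blast
  show thesis
  proof (rule that[of "\<epsilon>/4" \<theta>])
    fix P' Q1' Q2' and d :: "real^2"
    assume h: "norm (P' - P) < \<epsilon>/4" "norm (Q1' - Q1) < \<epsilon>/4" "norm (Q2' - Q2) < \<epsilon>/4" "norm d < \<epsilon>/4"
    \<comment> \<open>The distance in the product is at most the sum of the four norms, whence the
      quarter of \<open>\<epsilon>\<close>.\<close>
    have "dist (P', Q1', Q2', d) (P, Q1, Q2, 0) \<le> norm (P' - P) + (norm (Q1' - Q1) + (norm (Q2' - Q2) + norm d))"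
      unfolding dist_norm minus_prod_def fst_conv snd_conv diff_zero
      by (intro order_trans[OF norm_Pair_le] add_mono order_refl)
    then show "\<theta> < laplacian_sq_dist P' Q1' Q2' d" using \<epsilon>(2)[of "(P', Q1', Q2', d)"] h by simp
  qed (use \<epsilon> th in auto)
qed

section \<open>The comparison principle on small discs\<close>

text \<open>Multiplied by \<open>P$1$1 > 0\<close>, the contraction becomes
  \<open>det P * C$1$1\<close> plus the value of the form of \<open>C\<close> at the vector with
  entries \<open>- P$1$2\<close> and \<open>P$1$1\<close>. Only values of the quadratic form occur,
  so symmetry of mixed second partial derivatives never comes up.\<close>

lemma adj2_contraction_nonneg:
  fixes P C :: "real^2^2"
  assumes sym: "transpose P = P" and pd: "\<And>v. v \<noteq> 0 \<Longrightarrow> v \<bullet> (P *v v) > 0"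
    and C: "\<And>v. v \<bullet> (C *v v) \<ge> 0"
  shows "(\<Sum>i\<in>UNIV. \<Sum>j\<in>UNIV. adj2 P $ i $ j * C $ i $ j) \<ge> 0"
proof -
  note p = pos_def_2[OF sym pd]
  have e: "v \<bullet> (C *v v) = v$1 * (C$1$1 * v$1 + C$1$2 * v$2) + v$2 * (C$2$1 * v$1 + C$2$2 * v$2)" for v
    by (simp add: inner_vec_def sum_2 matrix_vector_mult_def)
  have c1: "C$1$1 \<ge> 0" using C[of "vector [1, 0]"] by (simp add: e)
  have c2: "(vector [- P$1$2, P$1$1] :: real^2) \<bullet> (C *v vector [- P$1$2, P$1$1]) \<ge> 0" by (rule C)
  have "P$1$1 * (\<Sum>i\<in>UNIV. \<Sum>j\<in>UNIV. adj2 P $ i $ j * C $ i $ j)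
     = det P * C$1$1 + (vector [- P$1$2, P$1$1] :: real^2) \<bullet> (C *v vector [- P$1$2, P$1$1])"
    unfolding e by (simp add: sum_2 det_2 p(1) algebra_simps)
  also have "\<dots> \<ge> 0" using c1 c2 p(4) by simp
  finally show ?thesis using p(2) by (simp add: zero_le_mult_iff)
qed

text \<open>At an interior minimum the gradient of the combination vanishes and its Hessian is
  nonnegative, so what remains is the contraction of the Hessian with the adjugate of the metric,
  divided by the determinant.\<close>

lemma coord_laplacian_local_min:
  fixes G :: "real^2 \<Rightarrow> real^2^2" and u :: "real^2 \<Rightarrow> real"
  assumes S: "open S" "x \<in> S" and u: "smooth_on S u"
    and G: "G differentiable (at x)"
    and sym: "\<And>y. y \<in> S \<Longrightarrow> transpose (G y) = G y"
    and pd: "\<And>y v. y \<in> S \<Longrightarrow> v \<noteq> 0 \<Longrightarrow> v \<bullet> (G y *v v) > 0"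
    and min: "\<And>y. y \<in> S \<Longrightarrow> a * u x + b * ((x - x0) \<bullet> (x - x0)) \<le> a * u y + b * ((y - x0) \<bullet> (y - x0))"
  shows "a * coord_laplacian G u x + b * coord_laplacian G (\<lambda>y. (y - x0) \<bullet> (y - x0)) x \<ge> 0"
proof -
  let ?q = "\<lambda>y. (y - x0) \<bullet> (y - x0)"
  have det: "det (G y) > 0" if "y \<in> S" for y using pos_def_2(4)[OF sym pd] that by blast
  have G': "(G has_derivative frechet_derivative G (at x)) (at x)"
    using G frechet_derivative_works by blast
  have du: "(u has_derivative frechet_derivative u (at y)) (at y)" if "y \<in> S" for y
    using smooth_on_differentiable[OF u that] frechet_derivative_works by blast
  have ddu: "((\<lambda>y. frechet_derivative u (at y) v) has_derivative
      frechet_derivative (\<lambda>y. frechet_derivative u (at y) v) (at x)) (at x)" for v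
    using smooth_on_frechet_derivative_differentiable[OF u S(2)] frechet_derivative_works by blast
  have pu: "partial_deriv j u differentiable (at x)" for j
    using smooth_on_frechet_derivative_differentiable[OF u S(2), of "axis j 1"] by (simp add: partial_deriv_def[abs_def])
  have pq: "partial_deriv j ?q differentiable (at x)" for j
    unfolding partial_deriv_sq_dist using has_derivative_coord differentiable_def by blast
  define f' where "f' = (\<lambda>y v. a * frechet_derivative u (at y) v + b * (2 * ((y - x0) \<bullet> v)))"
  have df: "((\<lambda>y. a * u y + b * ?q y) has_derivative f' y) (at y)" if "y \<in> S" for y
    unfolding f'_def by (auto intro!: derivative_eq_intros du[OF that] simp: inner_commute)
  define D where "D = (\<lambda>v w. a * frechet_derivative (\<lambda>y. frechet_derivative u (at y) v) (at x) w + b * (2 * (w \<bullet> v)))"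
  have ddf: "((\<lambda>y. f' y v) has_derivative D v) (at x)" for v
    unfolding f'_def D_def by (auto intro!: derivative_eq_intros ddu)
  note lm = local_min_second_derivative[OF S df ddf min]
  \<comment> \<open>The Hessian of the combination, assembled from the partial derivatives of its
    two terms.\<close>
  define C :: "real^2^2" where
    "C = (\<chi> i j. a * partial_deriv i (partial_deriv j u) x + b * partial_deriv i (partial_deriv j ?q) x)"
  have Cij: "C $ i $ j = a * partial_deriv i (partial_deriv j u) x + b * (if i = j then 2 else 0)" for i j
    unfolding C_def partial_deriv_sq_dist partial_deriv_coord by simp
  have first: "a * partial_deriv j u x + b * partial_deriv j ?q x = 0" for j
    using lm(1)[of "axis j 1"] unfolding partial_deriv_sq_dist
    by (simp add: f'_def partial_deriv_def inner_axis)
  have second: "v \<bullet> (C *v v) \<ge> 0" for v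
  proof -
    \<comment> \<open>The form of \<open>C\<close> at \<open>v\<close> has to be identified with
      \<open>D v v\<close>. This takes linearity of the derivative twice: in the inner direction at
      all points near \<open>x\<close>, and in the outer direction at \<open>x\<close>.\<close>
    have v: "v = v$1 *\<^sub>R axis 1 1 + v$2 *\<^sub>R axis 2 1"
      by (simp add: vec_eq_iff forall_2 axis_def)
    have lin: "L v = v$1 * L (axis 1 1) + v$2 * L (axis 2 1)" if "linear L" for L :: "real^2 \<Rightarrow> real"
      by (subst v) (simp add: linear_add[OF that] linear_cmul[OF that])
    have uv: "frechet_derivative u (at y) v = v$1 * partial_deriv 1 u y + v$2 * partial_deriv 2 u y" if "y \<in> S" for y
      unfolding partial_deriv_def by (rule lin[OF has_derivative_linear[OF du[OF that]]])
    have "((\<lambda>y. v$1 * partial_deriv 1 u y + v$2 * partial_deriv 2 u y) has_derivative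
        (\<lambda>w. v$1 * frechet_derivative (partial_deriv 1 u) (at x) w + v$2 * frechet_derivative (partial_deriv 2 u) (at x) w)) (at x)"
      using pu[unfolded frechet_derivative_works] by (auto intro!: derivative_eq_intros)
    then have "((\<lambda>y. frechet_derivative u (at y) v) has_derivative
        (\<lambda>w. v$1 * frechet_derivative (partial_deriv 1 u) (at x) w + v$2 * frechet_derivative (partial_deriv 2 u) (at x) w)) (at x)"
      by (rule has_derivative_transform_within_open[OF _ S]) (simp add: uv)
    from frechet_derivative_at[OF this, symmetric]
    have "frechet_derivative (\<lambda>y. frechet_derivative u (at y) v) (at x) v
       = v$1 * frechet_derivative (partial_deriv 1 u) (at x) v + v$2 * frechet_derivative (partial_deriv 2 u) (at x) v"
      by simp
    also have "\<dots> = v$1 * (v$1 * partial_deriv 1 (partial_deriv 1 u) x + v$2 * partial_deriv 2 (partial_deriv 1 u) x)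
        + v$2 * (v$1 * partial_deriv 1 (partial_deriv 2 u) x + v$2 * partial_deriv 2 (partial_deriv 2 u) x)"
      unfolding partial_deriv_def[of _ "partial_deriv _ u"]
      using lin[OF has_derivative_linear[OF pu[unfolded frechet_derivative_works]]] by simp
    finally have "v \<bullet> (C *v v) = D v v"
      unfolding D_def by (simp add: Cij inner_vec_def sum_2 matrix_vector_mult_def algebra_simps)
    then show ?thesis using lm(2)[of v] by simp
  qed
  define s where "s = sqrt (det (G x))"
  have s: "s > 0" using det[OF S(2)] by (simp add: s_def)
  define A where "A = (\<lambda>i j. adj_deriv (G x) (frechet_derivative G (at x) (axis i 1)) i j)"
  have L: "coord_laplacian G w x = 1 / s * (\<Sum>i\<in>UNIV. \<Sum>j\<in>UNIV.
      A i j * partial_deriv j w x + adj2 (G x) $ i $ j / s * partial_deriv i (partial_deriv j w) x)"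
    if "\<And>j. partial_deriv j w differentiable (at x)" for w
    unfolding s_def A_def by (rule coord_laplacian_2[OF S _ G' that]) (rule det)
  have eq: "a * (1 / s * (\<Sum>i\<in>UNIV. \<Sum>j\<in>UNIV. A i j * U j + A' i j / s * UU i j))
      + b * (1 / s * (\<Sum>i\<in>UNIV. \<Sum>j\<in>UNIV. A i j * W j + A' i j / s * WW i j))
     = 1 / s * (\<Sum>i\<in>UNIV. \<Sum>j\<in>UNIV. A i j * (a * U j + b * W j)
         + A' i j * (a * UU i j + b * WW i j) / s)" for U W :: "2 \<Rightarrow> real" and UU WW A'
    unfolding sum_2 by (simp add: algebra_simps add_divide_distrib)
  have "a * coord_laplacian G u x + b * coord_laplacian G ?q x
     = 1 / s * (\<Sum>i\<in>UNIV. \<Sum>j\<in>UNIV. adj2 (G x) $ i $ j * C $ i $ j / s)"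
    unfolding L[OF pu] L[OF pq] eq first by (simp add: C_def)
  also have "\<dots> = (\<Sum>i\<in>UNIV. \<Sum>j\<in>UNIV. adj2 (G x) $ i $ j * C $ i $ j) / (s * s)"
    by (simp add: sum_divide_distrib)
  also have "\<dots> \<ge> 0"
    using adj2_contraction_nonneg[OF sym[OF S(2)] pd[OF S(2)] second] s by simp
  finally show ?thesis .
qed

text \<open>Here \<open>h\<close> plays the role of \<lambda> - V. With q the squared distance to
  \<open>x0\<close>, the last inequality keeps 1 - \<kappa> q above 1/2 and 1 + \<kappa> q below
  3/2; \<open>2 * H \<le> \<kappa> * \<theta>\<close> then lets \<kappa> times the Laplacian of q
  dominate the zeroth order term for both functions.\<close>

definition small_disc :: "(real^2 \<Rightarrow> real^2^2) \<Rightarrow> (real^2 \<Rightarrow> real) \<Rightarrow> (real^2 \<Rightarrow> real) \<Rightarrow>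
    real^2 \<Rightarrow> real \<Rightarrow> real \<Rightarrow> real \<Rightarrow> real \<Rightarrow> bool" where
  "small_disc G u h x0 R \<theta> H \<kappa> \<longleftrightarrow> smooth_on (ball x0 R) u \<and>
     (\<forall>x\<in>ball x0 R. G differentiable (at x) \<and> transpose (G x) = G x \<and>
        (\<forall>v. v \<noteq> 0 \<longrightarrow> v \<bullet> (G x *v v) > 0) \<and>
        \<theta> < coord_laplacian G (\<lambda>y. (y - x0) \<bullet> (y - x0)) x \<and> \<bar>h x\<bar> \<le> H \<and>
        coord_laplacian G u x + h x * u x = 0) \<and>
     \<kappa> > 0 \<and> 2 * H \<le> \<kappa> * \<theta> \<and> \<kappa> * R\<^sup>2 \<le> 1 / 2"

text \<open>Since \<open>h\<close> may be positive, the maximum principle cannot be applied to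
  \<open>u\<close> directly. It is applied after division by the positive strict supersolution 1 -
  \<kappa> q: a negative value of the difference would give the quotient a negative minimum,
  necessarily inside \<open>W\<close>, where the second order condition is violated. The factor
  \<open>a\<close> will be 1 or -1, to treat both signs.\<close>

lemma comparison_principle:
  assumes disc: "small_disc G u h x0 R \<theta> H \<kappa>"
    and W: "open W" "bounded W" "closure W \<subseteq> ball x0 R" and \<delta>: "\<delta> \<ge> 0"
    and fr: "\<And>x. x \<in> frontier W \<Longrightarrow> \<delta> * (1 + \<kappa> * ((x - x0) \<bullet> (x - x0))) \<le> a * u x"
    and x: "x \<in> W"
  shows "\<delta> * (1 + \<kappa> * ((x - x0) \<bullet> (x - x0))) \<le> a * u x"
proof (rule ccontr)
  have u: "smooth_on (ball x0 R) u"
    and G: "\<And>x. x \<in> ball x0 R \<Longrightarrow> G differentiable (at x)"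
    and sym: "\<And>x. x \<in> ball x0 R \<Longrightarrow> transpose (G x) = G x"
    and pd: "\<And>x v. x \<in> ball x0 R \<Longrightarrow> v \<noteq> 0 \<Longrightarrow> v \<bullet> (G x *v v) > 0"
    and lap: "\<And>x. x \<in> ball x0 R \<Longrightarrow> \<theta> < coord_laplacian G (\<lambda>y. (y - x0) \<bullet> (y - x0)) x"
    and h: "\<And>x. x \<in> ball x0 R \<Longrightarrow> \<bar>h x\<bar> \<le> H"
    and eq: "\<And>x. x \<in> ball x0 R \<Longrightarrow> coord_laplacian G u x + h x * u x = 0"
    and \<kappa>: "\<kappa> > 0" "2 * H \<le> \<kappa> * \<theta>" "\<kappa> * R\<^sup>2 \<le> 1 / 2"
    using disc unfolding small_disc_def by blast+
  define q where "q = (\<lambda>y. (y - x0) \<bullet> (y - x0))"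
  define s where "s = (\<lambda>y. 1 + \<kappa> * q y)"
  define w where "w = (\<lambda>y. 1 - \<kappa> * q y)"
  assume "\<not> ?thesis"
  then have neg: "a * u x - \<delta> * s x < 0" by (simp add: s_def q_def)
  have q0: "0 \<le> q y" for y by (simp add: q_def)
  have qR: "\<kappa> * q y \<le> 1 / 2" if "y \<in> ball x0 R" for y
  proof -
    have "norm (y - x0) \<le> R" using that by (simp add: dist_norm norm_minus_commute)
    then have "q y \<le> R\<^sup>2" unfolding q_def dot_square_norm by (intro power_mono) auto
    then show ?thesis using \<kappa> by (meson mult_left_mono less_imp_le order_trans)
  qed
  have wpos: "w y \<ge> 1 / 2" if "y \<in> ball x0 R" for y using qR[OF that] by (simp add: w_def)
  have cK: "compact (closure W)" using W(2) by (simp add: compact_closure)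
  have "continuous_on (ball x0 R) u"
    by (intro continuous_at_imp_continuous_on ballI differentiable_imp_continuous_within smooth_on_differentiable[OF u])
  then have cu: "continuous_on (closure W) u" using W(3) continuous_on_subset by blast
  have "\<forall>y\<in>closure W. w y \<noteq> 0" using wpos W(3) by fastforce
  then have "continuous_on (closure W) (\<lambda>y. (a * u y - \<delta> * s y) / w y)"
    unfolding s_def w_def q_def by (intro continuous_intros cu) auto
  moreover have "closure W \<noteq> {}" using x closure_subset by auto
  ultimately obtain z where "z \<in> closure W"
      "\<forall>y\<in>closure W. (a * u z - \<delta> * s z) / w z \<le> (a * u y - \<delta> * s y) / w y"
    using continuous_attains_inf[OF cK] by blast
  then have z: "z \<in> closure W"
    "\<And>y. y \<in> closure W \<Longrightarrow> (a * u z - \<delta> * s z) / w z \<le> (a * u y - \<delta> * s y) / w y"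
    by auto
  \<comment> \<open>With this \<open>c\<close> the function \<open>a u - \<delta> s + c w\<close> touches \<open>0\<close> from above at \<open>z\<close>.  It differs from
    \<open>a u + b q\<close> by a constant, so no quotient has to be differentiated.\<close>
  define c where "c = - ((a * u z - \<delta> * s z) / w z)"
  have xcl: "x \<in> closure W" using x closure_subset by auto
  have zB: "z \<in> ball x0 R" using z(1) W(3) by auto
  have "(a * u x - \<delta> * s x) / w x < 0" using neg wpos[of x] xcl W(3) by (intro divide_neg_pos) fastforce+
  then have c: "c > 0" using z(2)[OF xcl] by (simp add: c_def)
  have ge: "a * u y - \<delta> * s y + c * w y \<ge> 0" if "y \<in> closure W" for y
  proof -
    have "w y > 0" using wpos[of y] that W(3) by fastforce
    moreover have "- c \<le> (a * u y - \<delta> * s y) / w y" using z(2)[OF that] by (simp add: c_def)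
    ultimately show ?thesis by (simp add: pos_le_divide_eq)
  qed
  have eqz: "a * u z - \<delta> * s z + c * w z = 0" using wpos[OF zB] by (simp add: c_def)
  have zW: "z \<in> W"
  proof (rule ccontr)
    assume "z \<notin> W"
    then have "z \<in> frontier W" using z(1) W(1) by (simp add: frontier_def interior_open)
    then have "\<delta> * s z \<le> a * u z" using fr by (simp add: s_def q_def)
    moreover have "c * w z > 0" using c wpos[OF zB] by simp
    ultimately show False using eqz by simp
  qed
  have WB: "W \<subseteq> ball x0 R" using W(3) closure_subset by blast
  define b where "b = - (\<kappa> * (\<delta> + c))"
  have form: "a * u y - \<delta> * s y + c * w y = a * u y + b * q y + (c - \<delta>)" for y
    by (simp add: b_def s_def w_def algebra_simps)
  let ?L = "coord_laplacian G (\<lambda>y. (y - x0) \<bullet> (y - x0)) z"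
  have "a * coord_laplacian G u z + b * ?L \<ge> 0"
  proof (rule coord_laplacian_local_min[OF W(1) zW])
    show "smooth_on W u" using u WB unfolding smooth_on_def by blast
    show "a * u z + b * ((z - x0) \<bullet> (z - x0)) \<le> a * u y + b * ((y - x0) \<bullet> (y - x0))" if "y \<in> W" for y
      using ge[of y] eqz that closure_subset[of W] unfolding form q_def by auto
  qed (use G sym pd zB WB in auto)
  moreover have "a * coord_laplacian G u z = - (h z * (a * u z))" using eq[OF zB] by (simp add: algebra_simps add_eq_0_iff)
  moreover have "a * u z = \<delta> * s z - c * w z" using eqz by simp
  \<comment> \<open>The brackets are the values at \<open>z\<close> of \<Delta>s + h s and of
    -(\<Delta>w + h w). The first is nonnegative and the second positive, which is the
    contradiction.\<close>
  ultimately have main: "\<delta> * (\<kappa> * ?L + h z * s z) + c * (\<kappa> * ?L - h z * w z) \<le> 0"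
    by (simp add: b_def algebra_simps)
  have kL: "2 * H < \<kappa> * ?L"
    using lap[OF zB] \<kappa> by (meson mult_strict_left_mono order_le_less_trans)
  have H: "\<bar>h z\<bar> \<le> H" "0 \<le> H" using h[OF zB] by auto
  have "\<bar>h z * s z\<bar> \<le> H * 2"
    unfolding abs_mult by (rule mult_mono) (use H q0[of z] qR[OF zB] \<kappa> in \<open>auto simp: s_def\<close>)
  then have "\<kappa> * ?L + h z * s z \<ge> 0" using kL by simp
  then have "\<delta> * (\<kappa> * ?L + h z * s z) \<ge> 0" using \<delta> by simp
  moreover have "\<bar>h z * w z\<bar> \<le> H * 1"
    unfolding abs_mult by (rule mult_mono) (use H q0[of z] qR[OF zB] \<kappa> in \<open>auto simp: w_def\<close>)
  then have "\<kappa> * ?L - h z * w z > 0" using kL H by simp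
  then have "c * (\<kappa> * ?L - h z * w z) > 0" using c by simp
  ultimately show False using main by simp
qed

lemma no_compact_nodal_component_disc:
  assumes disc: "small_disc G u h x0 R \<theta> H \<kappa>"
    and N: "N \<in> components {x \<in> ball x0 R. u x = 0}"
  shows "\<not> compact N"
proof (rule no_compact_nodal_component[OF _ _ _ _ _ _ N])
  have u: "smooth_on (ball x0 R) u" and \<kappa>: "\<kappa> > 0"
    using disc unfolding small_disc_def by blast+
  show cont: "continuous_on (ball x0 R) u"
    by (intro continuous_at_imp_continuous_on ballI differentiable_imp_continuous_within smooth_on_differentiable[OF u])
  fix W assume W: "open W" "bounded W" "closure W \<subseteq> ball x0 R"
  \<comment> \<open>Comparison with \<open>\<delta> = 0\<close> for both signs of \<open>a\<close>
    bounds \<open>u\<close> by zero from either side.\<close>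
  show "\<forall>x\<in>W. u x = 0" if "\<forall>x\<in>frontier W. u x = 0"
  proof
    fix x assume "x \<in> W"
    then show "u x = 0" using comparison_principle[OF disc W, of 0 1 x] comparison_principle[OF disc W, of 0 "-1" x] that by force
  qed
  \<comment> \<open>On the compact frontier \<open>a * u x\<close> exceeds a positive multiple of
    the subsolution; comparison carries this bound, and with it the strict sign, into
    \<open>W\<close>.\<close>
  have sgn: "\<forall>x\<in>W. 0 < a * u x" if fr: "\<forall>x\<in>frontier W. 0 < a * u x" for a
  proof -
    have sub: "frontier W \<subseteq> ball x0 R" using W(3) by (auto simp: frontier_def)
    have "compact (frontier W)" using W(2) by (simp add: compact_frontier_bounded)
    moreover have cf: "continuous_on (frontier W) (\<lambda>x. a * u x / (1 + \<kappa> * ((x - x0) \<bullet> (x - x0))))"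
      using \<kappa> by (intro continuous_intros continuous_on_subset[OF cont sub])
        (auto simp: add_nonneg_eq_0_iff)
    ultimately have "\<exists>\<delta>>0. \<forall>x\<in>frontier W. \<delta> \<le> a * u x / (1 + \<kappa> * ((x - x0) \<bullet> (x - x0)))"
    proof (cases "frontier W = {}")
      case True then show ?thesis by (auto intro: exI[of _ 1])
    next
      case False
      obtain z where z: "z \<in> frontier W"
        "\<forall>y\<in>frontier W. a * u z / (1 + \<kappa> * ((z - x0) \<bullet> (z - x0))) \<le> a * u y / (1 + \<kappa> * ((y - x0) \<bullet> (y - x0)))"
        using continuous_attains_inf[OF \<open>compact (frontier W)\<close> False cf] by blast
      have "1 + \<kappa> * ((z - x0) \<bullet> (z - x0)) > 0" using \<kappa> by (simp add: add_pos_nonneg)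
      then have "0 < a * u z / (1 + \<kappa> * ((z - x0) \<bullet> (z - x0)))" using fr z(1) by simp
      then show ?thesis using z(2) by blast
    qed
    then obtain \<delta> where \<delta>: "\<delta> > 0" "\<And>x. x \<in> frontier W \<Longrightarrow> \<delta> \<le> a * u x / (1 + \<kappa> * ((x - x0) \<bullet> (x - x0)))"
      by blast
    have sp: "1 + \<kappa> * ((x - x0) \<bullet> (x - x0)) > 0" for x using \<kappa> by (simp add: add_pos_nonneg)
    show ?thesis
    proof
      fix x assume xW: "x \<in> W"
      have "\<delta> * (1 + \<kappa> * ((y - x0) \<bullet> (y - x0))) \<le> a * u y" if "y \<in> frontier W" for y
        using \<delta>(2)[OF that] sp[of y] by (simp only: pos_le_divide_eq)
      then have "\<delta> * (1 + \<kappa> * ((x - x0) \<bullet> (x - x0))) \<le> a * u x"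
        by (rule comparison_principle[OF disc W less_imp_le[OF \<delta>(1)] _ xW])
      moreover have "\<delta> * (1 + \<kappa> * ((x - x0) \<bullet> (x - x0))) > 0" using \<delta>(1) sp by simp
      ultimately show "0 < a * u x" by linarith
    qed
  qed
  show "\<forall>x\<in>W. u x > 0" if "\<forall>x\<in>frontier W. u x > 0" using sgn[of 1] that by simp
  show "\<forall>x\<in>W. u x < 0" if "\<forall>x\<in>frontier W. u x < 0" using sgn[of "-1"] that by simp
qed auto

section \<open>Geodesic balls inside coordinate balls\<close>

lemma smooth_atlas_chart:
  assumes "smooth_atlas A" "c \<in> A"
  shows chart_open_domain: "open (fst c)" and chart_open_image: "open (chart_image c)"
    and chart_homeomorphism: "homeomorphism (fst c) (chart_image c) (snd c) (chart_inv c)"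
  using assms unfolding smooth_atlas_def is_chart_def by auto

lemma chart_simps:
  assumes "smooth_atlas A" "c \<in> A"
  shows chart_inv_snd: "p \<in> fst c \<Longrightarrow> chart_inv c (snd c p) = p"
    and snd_chart_inv: "x \<in> chart_image c \<Longrightarrow> snd c (chart_inv c x) = x"
    and chart_inv_mem: "x \<in> chart_image c \<Longrightarrow> chart_inv c x \<in> fst c"
    and snd_mem_chart_image: "p \<in> fst c \<Longrightarrow> snd c p \<in> chart_image c"
  using chart_homeomorphism[OF assms] unfolding homeomorphism_def by auto

lemma chart_continuous:
  assumes "smooth_atlas A" "c \<in> A"
  shows continuous_on_snd_chart: "continuous_on (fst c) (snd c)"
    and continuous_on_chart_inv: "continuous_on (chart_image c) (chart_inv c)"
  using chart_homeomorphism[OF assms] unfolding homeomorphism_def by auto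

lemma chart_inv_open_image:
  assumes "smooth_atlas A" "c \<in> A" "open S" "S \<subseteq> chart_image c"
  shows "open (chart_inv c ` S)"
proof -
  have "homeomorphism (chart_image c) (fst c) (chart_inv c) (snd c)"
    using chart_homeomorphism[OF assms(1,2)] homeomorphism_symD by blast
  then have "openin (top_of_set (fst c)) (chart_inv c ` S)"
    by (rule homeomorphism_imp_open_map)
      (use assms(3,4) chart_open_image[OF assms(1,2)] in \<open>simp add: openin_open_eq\<close>)
  then show ?thesis using chart_open_domain[OF assms(1,2)] openin_open_trans by blast
qed

lemma chart_exists:
  assumes "smooth_atlas A"
  obtains c where "c \<in> A" "p \<in> fst c"
  using assms unfolding smooth_atlas_def by blast

lemma chart_cball:
  assumes "smooth_atlas A" "c \<in> A" "p \<in> fst c"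
  obtains R where "R > 0" "cball (snd c p) R \<subseteq> chart_image c"
  using chart_open_image[OF assms(1,2)] snd_mem_chart_image[OF assms] open_contains_cball by blast

lemma smooth_on_continuous_on:
  "smooth_on S f \<Longrightarrow> continuous_on S f"
  by (intro continuous_at_imp_continuous_on ballI differentiable_imp_continuous_within
      smooth_on_differentiable)

section \<open>Bounds for the metric on compact sets\<close>

lemma continuous_on_quadratic_form:
  fixes G :: "'b::topological_space \<Rightarrow> real^'n^'n"
  assumes "continuous_on S G" "continuous_on S v"
  shows "continuous_on S (\<lambda>x. v x \<bullet> (G x *v v x))"
  unfolding inner_vec_def matrix_vector_mult_def vec_lambda_beta
  using assms by (intro continuous_intros) auto

text \<open>The form is positive and continuous on the compact product of \<open>K\<close> with the
  unit sphere; its minimum there extends to all vectors by homogeneity.\<close>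

lemma quadratic_form_lower_bound:
  fixes G :: "'b::topological_space \<Rightarrow> real^'n^'n"
  assumes K: "compact K" and G: "continuous_on K G"
    and pd: "\<And>x v. x \<in> K \<Longrightarrow> v \<noteq> 0 \<Longrightarrow> v \<bullet> (G x *v v) > 0"
  obtains m where "m > 0" "\<And>x v. x \<in> K \<Longrightarrow> m * (v \<bullet> v) \<le> v \<bullet> (G x *v v)"
proof -
  have "\<exists>m>0. \<forall>z\<in>K \<times> sphere 0 1. m \<le> snd z \<bullet> (G (fst z) *v snd z)"
  proof (cases "K \<times> sphere (0::real^'n) 1 = {}")
    case True then show ?thesis by (metis empty_iff zero_less_one)
  next
    case False
    have cont: "continuous_on (K \<times> sphere 0 1) (\<lambda>z. snd z \<bullet> (G (fst z) *v snd z))"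
      by (intro continuous_on_quadratic_form continuous_intros continuous_on_compose2[OF G]) auto
    have comp: "compact (K \<times> sphere (0::real^'n) 1)" using K by (intro compact_Times) auto
    obtain z where z: "z \<in> K \<times> sphere 0 1"
      "\<forall>y\<in>K \<times> sphere 0 1. snd z \<bullet> (G (fst z) *v snd z) \<le> snd y \<bullet> (G (fst y) *v snd y)"
      using continuous_attains_inf[OF comp False cont] by blast
    have "snd z \<noteq> 0" using z(1) by auto
    then have "snd z \<bullet> (G (fst z) *v snd z) > 0" using z(1) by (intro pd) auto
    then show ?thesis using z(2) by blast
  qed
  then obtain m where m: "m > 0" "\<And>x w. x \<in> K \<Longrightarrow> norm w = 1 \<Longrightarrow> m \<le> w \<bullet> (G x *v w)" by force
  show thesis
  proof (rule that[OF m(1)])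
    fix x and v :: "real^'n" assume x: "x \<in> K"
    show "m * (v \<bullet> v) \<le> v \<bullet> (G x *v v)"
    proof (cases "v = 0")
      case False
      define w where "w = (1 / norm v) *\<^sub>R v"
      have w: "norm w = 1" "v = norm v *\<^sub>R w" using False by (auto simp: w_def)
      have "v \<bullet> (G x *v v) = (norm v)\<^sup>2 * (w \<bullet> (G x *v w))"
        by (subst (1 2) w(2)) (simp only: matrix_vector_mult_scaleR inner_scaleR_left inner_scaleR_right power2_eq_square mult.assoc)
      moreover have "m * (norm v)\<^sup>2 \<le> (w \<bullet> (G x *v w)) * (norm v)\<^sup>2"
        by (intro mult_right_mono m(2)[OF x w(1)]) simp
      ultimately show ?thesis by (simp add: dot_square_norm mult.commute)
    qed simp
  qed
qed

section \<open>A continuously differentiable bump function\<close>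

lemma DERIV_max_0_sq: "((\<lambda>r::real. (max 0 r)\<^sup>2) has_real_derivative 2 * max 0 r) (at r)"
proof -
  consider "r > 0" | "r < 0" | "r = 0" by linarith
  then show ?thesis
  proof cases
    case 1
    have "((\<lambda>r::real. r\<^sup>2) has_real_derivative 2 * max 0 r) (at r)"
      using 1 by (auto intro!: derivative_eq_intros)
    then show ?thesis by (rule has_field_derivative_transform_within_open[where S="{0<..}"]) (use 1 in auto)
  next
    case 2
    have "((\<lambda>r::real. 0) has_real_derivative 2 * max 0 r) (at r)" using 2 by auto
    then show ?thesis by (rule has_field_derivative_transform_within_open[where S="{..<0}"]) (use 2 in auto)
  next
    case 3
    \<comment> \<open>At the corner the difference quotient is bounded by the absolute value of
      \<open>h\<close>.\<close>
    have "((\<lambda>h::real. (max 0 h)\<^sup>2 / h) \<longlongrightarrow> 0) (at 0)"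
    proof (rule Lim_null_comparison)
      show "\<forall>\<^sub>F h::real in at 0. norm ((max 0 h)\<^sup>2 / h) \<le> \<bar>h\<bar>"
        by (intro always_eventually allI) (auto simp: max_def power2_eq_square)
      show "((\<lambda>h::real. \<bar>h\<bar>) \<longlongrightarrow> 0) (at 0)" by (rule tendsto_rabs_zero) (rule tendsto_ident_at)
    qed
    then show ?thesis using 3 by (simp add: DERIV_def)
  qed
qed

text \<open>Squaring the positive part makes the bump \<open>C^1\<close>, so that, extended by \<open>0\<close>, it can be differentiated
  along a curve that leaves the chart.\<close>

definition bump :: "real^'n::finite \<Rightarrow> real \<Rightarrow> real^'n \<Rightarrow> real" where
  "bump x0 R y = (max 0 (R\<^sup>2 - (y - x0) \<bullet> (y - x0)))\<^sup>2"

lemma bump_eq_0: "y \<notin> ball x0 R \<Longrightarrow> R > 0 \<Longrightarrow> bump x0 R y = 0"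
proof -
  assume "y \<notin> ball x0 R" "R > 0"
  then have "R \<le> norm (y - x0)" by (simp add: dist_norm norm_minus_commute)
  then have "R\<^sup>2 \<le> (y - x0) \<bullet> (y - x0)" unfolding dot_square_norm using \<open>R > 0\<close> by (intro power_mono) auto
  then show ?thesis by (simp add: bump_def)
qed

lemma has_derivative_bump:
  "(bump x0 R has_derivative (\<lambda>v. 2 * max 0 (R\<^sup>2 - (y - x0) \<bullet> (y - x0)) * (- 2 * ((y - x0) \<bullet> v)))) (at y)"
proof -
  have "((\<lambda>y. R\<^sup>2 - (y - x0) \<bullet> (y - x0)) has_derivative (\<lambda>v. - 2 * ((y - x0) \<bullet> v))) (at y)"
    by (auto intro!: derivative_eq_intros simp: inner_commute)
  from DERIV_compose_FDERIV[OF DERIV_max_0_sq this] show ?thesis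
    by (simp add: bump_def[abs_def] mult_ac)
qed

text \<open>Outside the ball the positive part vanishes, so \<open>v\<close> has to be controlled
  only inside, where the bound on the metric is available. Inside, the two factors are at most
  \<open>2 * R^2\<close> and \<open>2 * R * B\<close>.\<close>

lemma bump_derivative_bound:
  assumes "R > 0" and "y \<in> ball x0 R \<Longrightarrow> norm v \<le> B" "B \<ge> 0"
  shows "\<bar>2 * max 0 (R\<^sup>2 - (y - x0) \<bullet> (y - x0)) * (- 2 * ((y - x0) \<bullet> v))\<bar> \<le> 4 * R ^ 3 * B"
proof (cases "y \<in> ball x0 R")
  case True
  then have n: "norm (y - x0) \<le> R" by (simp add: dist_norm norm_minus_commute)
  have "\<bar>(y - x0) \<bullet> v\<bar> \<le> R * B"
    by (rule order_trans[OF Cauchy_Schwarz_ineq2 mult_mono]) (use n assms True in auto)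
  moreover have "\<bar>max 0 (R\<^sup>2 - (y - x0) \<bullet> (y - x0))\<bar> \<le> R\<^sup>2" by simp
  ultimately have "\<bar>max 0 (R\<^sup>2 - (y - x0) \<bullet> (y - x0))\<bar> * \<bar>(y - x0) \<bullet> v\<bar> \<le> R\<^sup>2 * (R * B)"
    by (intro mult_mono) auto
  then show ?thesis by (simp add: abs_mult power2_eq_square power3_eq_cube)
next
  case False
  then have "R \<le> norm (y - x0)" by (simp add: dist_norm norm_minus_commute)
  then have "R\<^sup>2 \<le> (y - x0) \<bullet> (y - x0)" unfolding dot_square_norm using assms(1) by (intro power_mono) auto
  then show ?thesis using assms by simp
qed

section \<open>Lengths of curves in different charts\<close>

lemma riemannian_metric_continuous:
  "riemannian_metric A g \<Longrightarrow> c \<in> A \<Longrightarrow> continuous_on (chart_image c) (g c \<circ> chart_inv c)"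
  unfolding riemannian_metric_def smooth_field_def by (blast intro: smooth_on_continuous_on)

lemma riemannian_metric_transform:
  assumes "riemannian_metric A g" "c \<in> A" "d \<in> A" "p \<in> fst c" "p \<in> fst d"
  shows "v \<bullet> (g c p *v v) =
     (matrix (frechet_derivative (transition c d) (at (snd c p))) *v v)
       \<bullet> (g d p *v (matrix (frechet_derivative (transition c d) (at (snd c p))) *v v))"
proof -
  define J where "J = matrix (frechet_derivative (transition c d) (at (snd c p)))"
  have "g c p = transpose J ** g d p ** J"
    using assms unfolding riemannian_metric_def J_def Let_def by blast
  then have "v \<bullet> (g c p *v v) = v \<bullet> (transpose J *v (g d p *v (J *v v)))"
    by (simp add: matrix_vector_mul_assoc matrix_mul_assoc)
  also have "\<dots> = (J *v v) \<bullet> (g d p *v (J *v v))"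
    unfolding transpose_matrix_vector by (metis dot_lmul_matrix inner_commute)
  finally show ?thesis by (simp add: J_def)
qed

lemma C1_speed_continuous:
  assumes "riemannian_metric A g" "d \<in> A" and u: "u C1_differentiable_on {0..1}" "u ` {0..1} \<subseteq> chart_image d"
  shows "continuous_on {0..1} (\<lambda>s. sqrt (vector_derivative u (at s) \<bullet>
      ((g d \<circ> chart_inv d) (u s) *v vector_derivative u (at s))))"
proof -
  have "continuous_on {0..1} u" using u(1) C1_differentiable_imp_continuous_on by blast
  then have "continuous_on {0..1} (\<lambda>s. (g d \<circ> chart_inv d) (u s))"
    using continuous_on_compose2[OF riemannian_metric_continuous[OF assms(1,2)]] u(2) by blast
  moreover have "continuous_on {0..1} (\<lambda>s. vector_derivative u (at s))"
    using u(1) C1_differentiable_on_eq by blast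
  ultimately show ?thesis by (intro continuous_on_real_sqrt continuous_on_quadratic_form)
qed

text \<open>Along a curve the bump, extended by zero, changes at a rate of at most
  \<open>4 * R ^ 3 / sqrt m\<close> times the speed. The fundamental theorem of calculus turns this
  into a bound for each piece, and induction adds the pieces. A piece may lie in a chart
  \<open>d\<close> different from \<open>c\<close>.\<close>

lemma bump_curve_bound:
  fixes A :: "('a::t2_space, 'n::finite) chart set"
  assumes A: "smooth_atlas A" and g: "riemannian_metric A g" and c: "c \<in> A"
    and R: "R > 0" "cball x0 R \<subseteq> chart_image c"
    and m: "m > 0" "\<And>x v. x \<in> cball x0 R \<Longrightarrow> m * (v \<bullet> v) \<le> v \<bullet> (g c (chart_inv c x) *v v)"
    and pq: "curve_of_length A g p q L"
  defines "\<rho> \<equiv> \<lambda>p. if p \<in> fst c then bump x0 R (snd c p) else 0"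
  shows "\<bar>\<rho> q - \<rho> p\<bar> \<le> 4 * R ^ 3 / sqrt m * L"
  using pq
proof induction
  case (trivial p)
  show ?case by simp
next
  case (append p q L d u r)
  define \<nu> where "\<nu> = (\<lambda>s. sqrt (vector_derivative u (at s) \<bullet>
      ((g d \<circ> chart_inv d) (u s) *v vector_derivative u (at s))))"
  define C where "C = 4 * R ^ 3 / sqrt m"
  define f where "f = (\<lambda>s. \<rho> (chart_inv d (u s)))"
  have dA: "d \<in> A" by fact
  \<comment> \<open>The coordinate ball is compact, hence closed in the Hausdorff space. So a point
    outside the domain of \<open>c\<close> has a whole neighbourhood on which the extended bump is
    zero.\<close>
  have cl: "closed (chart_inv c ` cball x0 R)"
    by (intro compact_imp_closed compact_continuous_image
        continuous_on_subset[OF continuous_on_chart_inv[OF A c] R(2)]) simp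
  have \<rho>0: "\<rho> x = 0" if "x \<notin> chart_inv c ` cball x0 R" for x
  proof (cases "x \<in> fst c")
    case True
    have "snd c x \<notin> ball x0 R"
      using that chart_inv_snd[OF A c True] by (metis ball_subset_cball image_eqI subsetD)
    from bump_eq_0[OF this R(1)] show ?thesis by (simp add: \<rho>_def)
  qed (simp add: \<rho>_def)
  have \<nu>0: "\<nu> s \<ge> 0" if "s \<in> {0..1}" for s
  proof -
    have us: "u s \<in> chart_image d" using append that by auto
    have "v \<bullet> (g d (chart_inv d (u s)) *v v) \<ge> 0" for v
      using g dA chart_inv_mem[OF A dA us] unfolding riemannian_metric_def
      by (cases "v = 0") (auto intro!: less_imp_le)
    then show ?thesis by (simp add: \<nu>_def)
  qed
  have der: "\<exists>D. (f has_vector_derivative D) (at s) \<and> \<bar>D\<bar> \<le> C * \<nu> s" if s: "s \<in> {0..1}" for s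
  proof -
    have us: "u s \<in> chart_image d" using append s by auto
    have du: "(u has_vector_derivative vector_derivative u (at s)) (at s)"
      using append(3) s unfolding C1_differentiable_on_eq vector_derivative_works by blast
    define w where "w = vector_derivative u (at s)"
    have cu: "continuous (at s) u" using du has_vector_derivative_continuous by blast
    \<comment> \<open>Derivatives of \<open>u\<close> are two-sided even at the endpoints 0 and 1,
      so the neighbourhood may leave the unit interval. Continuity of \<open>u\<close> at
      \<open>s\<close> is what keeps the curve in the chart there.\<close>
    have near: "\<exists>T. open T \<and> s \<in> T \<and> (\<forall>s'\<in>T. u s' \<in> chart_image d \<and> chart_inv d (u s') \<in> X)"
      if X: "open X" "chart_inv d (u s) \<in> X" for X
    proof -
      define Y where "Y = chart_image d \<inter> chart_inv d -` X"
      have "open Y" unfolding Y_def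
        by (rule continuous_open_preimage[OF continuous_on_chart_inv[OF A dA] chart_open_image[OF A dA] X(1)])
      moreover have uY: "u s \<in> Y" using us X(2) by (simp add: Y_def)
      ultimately have "\<forall>\<^sub>F s' in at s. u s' \<in> Y"
        by (rule topological_tendstoD[OF cu[unfolded isCont_def]])
      then have "\<forall>\<^sub>F s' in nhds s. u s' \<in> Y" using uY by (simp add: eventually_nhds_conv_at)
      then show ?thesis unfolding eventually_nhds Y_def by blast
    qed
    show ?thesis
    proof (cases "chart_inv d (u s) \<in> fst c")
      case True
      obtain T where T: "open T" "s \<in> T" "\<And>s'. s' \<in> T \<Longrightarrow> chart_inv d (u s') \<in> fst c"
        using near[OF chart_open_domain[OF A c] True] by blast
      define \<tau> where "\<tau> = transition d c"
      define D\<tau> where "D\<tau> = frechet_derivative \<tau> (at (u s))"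
      let ?p = "chart_inv d (u s)"
      have pd: "?p \<in> fst d" and sp: "snd d ?p = u s"
        using chart_inv_mem[OF A dA us] snd_chart_inv[OF A dA us] by auto
      have "smooth_on (snd d ` (fst d \<inter> fst c)) \<tau>"
        using A c dA unfolding smooth_atlas_def \<tau>_def by blast
      moreover have "u s \<in> snd d ` (fst d \<inter> fst c)" using pd sp True by (metis IntI image_eqI)
      ultimately have "\<tau> differentiable (at (u s))" by (rule smooth_on_differentiable)
      then have d\<tau>: "(\<tau> has_derivative D\<tau>) (at (u s))"
        unfolding D\<tau>_def using frechet_derivative_works by blast
      have \<tau>: "\<tau> (u s) = snd c ?p" by (simp add: \<tau>_def transition_def)
      define y where "y = snd c ?p"
      have "((\<lambda>s. bump x0 R (\<tau> (u s))) has_derivative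
          (\<lambda>h. 2 * max 0 (R\<^sup>2 - (y - x0) \<bullet> (y - x0)) * (- 2 * ((y - x0) \<bullet> D\<tau> (h *\<^sub>R w))))) (at s)"
        using has_derivative_compose[OF has_derivative_compose[OF du[unfolded has_vector_derivative_def] d\<tau>]
            has_derivative_bump] by (simp add: \<tau> y_def w_def)
      then have "((\<lambda>s. bump x0 R (\<tau> (u s))) has_vector_derivative
          2 * max 0 (R\<^sup>2 - (y - x0) \<bullet> (y - x0)) * (- 2 * ((y - x0) \<bullet> D\<tau> w))) (at s)"
        unfolding has_vector_derivative_def
        by (rule has_derivative_eq_rhs) (simp add: fun_eq_iff linear_cmul[OF has_derivative_linear[OF d\<tau>]])
      then have fd: "(f has_vector_derivative
          2 * max 0 (R\<^sup>2 - (y - x0) \<bullet> (y - x0)) * (- 2 * ((y - x0) \<bullet> D\<tau> w))) (at s)"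
        by (rule has_vector_derivative_transform_within_open[OF _ T(1,2)])
          (use T(3) in \<open>simp add: f_def \<rho>_def \<tau>_def transition_def\<close>)
      have "\<bar>2 * max 0 (R\<^sup>2 - (y - x0) \<bullet> (y - x0)) * (- 2 * ((y - x0) \<bullet> D\<tau> w))\<bar> \<le> 4 * R ^ 3 * (\<nu> s / sqrt m)"
      proof (rule bump_derivative_bound[OF R(1)])
        show "0 \<le> \<nu> s / sqrt m" using \<nu>0[OF s] m(1) by simp
        assume "y \<in> ball x0 R"
        then have yc: "y \<in> cball x0 R" by auto
        have py: "chart_inv c y = ?p" unfolding y_def by (rule chart_inv_snd[OF A c True])
        \<comment> \<open>\<open>D\<tau> w\<close> is the velocity read in the chart
          \<open>c\<close>. Its metric length equals that of \<open>w\<close> in the chart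
          \<open>d\<close>, and \<open>m\<close> bounds its Euclidean length in terms of it.\<close>
        have "matrix D\<tau> *v w = D\<tau> w"
          using matrix_works[OF has_derivative_linear[OF d\<tau>, THEN linear_matrix_vector_mul_eq[THEN iffD2]]] by simp
        then have eq: "D\<tau> w \<bullet> (g c ?p *v D\<tau> w) = w \<bullet> (g d ?p *v w)"
          using riemannian_metric_transform[OF g dA c pd True, of w] by (simp add: sp D\<tau>_def \<tau>_def)
        have "m * (D\<tau> w \<bullet> D\<tau> w) \<le> w \<bullet> (g d ?p *v w)"
          using m(2)[OF yc, of "D\<tau> w"] by (simp add: py eq)
        then have "sqrt (m * (D\<tau> w \<bullet> D\<tau> w)) \<le> \<nu> s" by (simp add: \<nu>_def w_def)
        then have "sqrt m * norm (D\<tau> w) \<le> \<nu> s" by (simp add: real_sqrt_mult norm_eq_sqrt_inner)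
        then show "norm (D\<tau> w) \<le> \<nu> s / sqrt m" using m(1) by (simp add: pos_le_divide_eq mult.commute)
      qed
      then show ?thesis using fd by (auto simp: C_def)
    next
      case False
      have "chart_inv d (u s) \<in> - (chart_inv c ` cball x0 R)"
        using False chart_inv_mem[OF A c] R(2) by auto
      then obtain T where T: "open T" "s \<in> T" "\<And>s'. s' \<in> T \<Longrightarrow> chart_inv d (u s') \<in> - (chart_inv c ` cball x0 R)"
        using near[of "- (chart_inv c ` cball x0 R)"] cl by (auto simp: open_Compl)
      have "((\<lambda>s. 0::real) has_vector_derivative 0) (at s)" by (rule has_vector_derivative_const)
      then have "(f has_vector_derivative 0) (at s)"
        by (rule has_vector_derivative_transform_within_open[OF _ T(1,2)]) (use T(3) \<rho>0 in \<open>simp add: f_def\<close>)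
      moreover have "0 \<le> C * \<nu> s" using \<nu>0[OF s] m(1) R(1) by (simp add: C_def)
      ultimately show ?thesis by (intro exI[of _ 0]) auto
    qed
  qed
  then obtain f' where f': "\<And>s. s \<in> {0..1} \<Longrightarrow> (f has_vector_derivative f' s) (at s)"
    "\<And>s. s \<in> {0..1} \<Longrightarrow> \<bar>f' s\<bar> \<le> C * \<nu> s" by metis
  have ftc: "(f' has_integral (f 1 - f 0)) {0..1}"
    by (rule fundamental_theorem_of_calculus[OF _ has_vector_derivative_at_within[OF f'(1)]]) simp_all
  have "continuous_on {0..1} \<nu>"
    unfolding \<nu>_def by (rule C1_speed_continuous[OF g dA append(3,4)])
  then have \<nu>i: "(\<lambda>s. C * \<nu> s) integrable_on {0..1}"
    by (intro integrable_continuous_interval continuous_intros)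
  have "norm (integral {0..1} f') \<le> integral {0..1} (\<lambda>s. C * \<nu> s)"
    by (rule integral_norm_bound_integral[OF has_integral_integrable[OF ftc] \<nu>i]) (use f'(2) in auto)
  then have "\<bar>f 1 - f 0\<bar> \<le> C * coord_length (g d \<circ> chart_inv d) u"
    by (simp add: integral_unique[OF ftc] coord_length_def \<nu>_def)
  then have "\<bar>\<rho> r - \<rho> q\<bar> \<le> C * coord_length (g d \<circ> chart_inv d) u"
    using append by (simp add: f_def)
  then show ?case using append.IH by (simp add: C_def[symmetric] distrib_left)
qed

text \<open>This makes the set in the definition of \<open>riem_dist\<close> nonempty, so that its
  infimum is meaningful. Points of one coordinate ball are joined by a straight segment in
  coordinates, so reachability from \<open>p\<close> is locally constant, and the manifold is
  connected.\<close>

lemma curve_of_length_exists: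
  fixes A :: "('a::t2_space, 'n::finite) chart set"
    and p q :: 'a
  assumes A: "smooth_atlas A" and con: "connected (UNIV :: 'a set)"
  shows "\<exists>L. curve_of_length A g p q L"
proof -
  define P where "P = (\<lambda>q. \<exists>L. curve_of_length A g p q L)"
  have "P q"
  proof (rule connected_induction_simple[OF con UNIV_I UNIV_I])
    show "P p" unfolding P_def by (rule exI[of _ 0]) (rule curve_of_length.trivial)
    fix a :: 'a
    obtain c where c: "c \<in> A" "a \<in> fst c" using chart_exists[OF A] by blast
    obtain R where R: "R > 0" "cball (snd c a) R \<subseteq> chart_image c" using chart_cball[OF A c] by blast
    have sub: "ball (snd c a) R \<subseteq> chart_image c" using R(2) by (meson ball_subset_cball order_trans)
    define T where "T = chart_inv c ` ball (snd c a) R"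
    have "open T" unfolding T_def by (rule chart_inv_open_image[OF A c(1) open_ball sub])
    moreover have "a \<in> T" unfolding T_def
      using chart_inv_snd[OF A c] R(1) by (metis centre_in_ball image_eqI)
    moreover have "P y" if x: "x \<in> T" and y: "y \<in> T" and L: "P x" for x y
    proof -
      obtain x' y' where x': "x' \<in> ball (snd c a) R" "x = chart_inv c x'"
        and y': "y' \<in> ball (snd c a) R" "y = chart_inv c y'" using x y by (auto simp: T_def)
      define u where "u = (\<lambda>s::real. x' + s *\<^sub>R (y' - x'))"
      have "(u has_vector_derivative (y' - x')) (at s)" for s
        unfolding u_def by (auto intro!: derivative_eq_intros simp: has_vector_derivative_def)
      then have "u C1_differentiable_on {0..1}"
        unfolding C1_differentiable_on_def by (intro exI[of _ "\<lambda>_. y' - x'"]) auto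
      moreover have "u ` {0..1} \<subseteq> ball (snd c a) R"
      proof
        fix z assume "z \<in> u ` {0..1}"
        then obtain s where s: "0 \<le> s" "s \<le> 1" "z = u s" by auto
        have "z = (1 - s) *\<^sub>R x' + s *\<^sub>R y'" by (simp add: s(3) u_def algebra_simps)
        then show "z \<in> ball (snd c a) R"
          using convexD_alt[OF convex_ball x'(1) y'(1) s(1,2)] by simp
      qed
      moreover have "chart_inv c (u 0) = x" "chart_inv c (u 1) = y" by (simp_all add: u_def x' y')
      moreover from L[unfolded P_def] obtain L where "curve_of_length A g p x L" ..
      ultimately have "curve_of_length A g p y (L + coord_length (g c \<circ> chart_inv c) u)"
        using sub by (intro curve_of_length.append[OF _ c(1)]) auto
      then show ?thesis unfolding P_def ..
    qed
    moreover from calculation(1) have "openin (top_of_set UNIV) T" by simp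
    ultimately show "\<exists>T. openin (top_of_set UNIV) T \<and> a \<in> T \<and> (\<forall>x\<in>T. \<forall>y\<in>T. P x \<longrightarrow> P y)"
      by blast
  qed
  then show ?thesis unfolding P_def .
qed

text \<open>The extended bump is large on the half ball and zero off the full ball, while it changes
  at most by a constant times the length of a curve; so leaving the coordinate ball costs a definite
  length.\<close>

lemma geodesic_balls_in_coordinate_ball:
  fixes A :: "('a::t2_space, 'n::finite) chart set"
  assumes A: "smooth_atlas A" and con: "connected (UNIV :: 'a set)"
    and g: "riemannian_metric A g" and c: "c \<in> A"
    and R: "R > 0" "cball x0 R \<subseteq> chart_image c"
  obtains \<delta> where "\<delta> > 0"
    "\<And>p. p \<in> chart_inv c ` ball x0 (R / 2) \<Longrightarrow> geodesic_ball A g p \<delta> \<subseteq> chart_inv c ` ball x0 R"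
proof -
  have cG: "continuous_on (cball x0 R) (g c \<circ> chart_inv c)"
    using riemannian_metric_continuous[OF g c] R(2) continuous_on_subset by blast
  have pd: "v \<bullet> ((g c \<circ> chart_inv c) x *v v) > 0" if "x \<in> cball x0 R" "v \<noteq> 0" for x v
    using g c chart_inv_mem[OF A c] R(2) that unfolding riemannian_metric_def by auto
  obtain m where m: "m > 0" "\<And>x v. x \<in> cball x0 R \<Longrightarrow> m * (v \<bullet> v) \<le> v \<bullet> ((g c \<circ> chart_inv c) x *v v)"
    by (rule quadratic_form_lower_bound[OF compact_cball cG pd]) auto
  define C where "C = 4 * R ^ 3 / sqrt m"
  have C: "C > 0" using m(1) R(1) by (simp add: C_def)
  define \<rho> where "\<rho> = (\<lambda>p. if p \<in> fst c then bump x0 R (snd c p) else 0)"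
  show thesis
  proof (rule that)
    \<comment> \<open>On the half ball the bump is at least the square of
      \<open>3 / 4 * R^2\<close>, which exceeds \<open>R ^ 4 / 2\<close>. A curve of length
      \<open>L\<close> lowers it by at most \<open>C * L\<close>, so below this radius it stays
      positive.\<close>
    show "R ^ 4 / (2 * C) > 0" using C R(1) by simp
    fix p assume "p \<in> chart_inv c ` ball x0 (R / 2)"
    then obtain x where x: "x \<in> ball x0 (R / 2)" "p = chart_inv c x" by auto
    have "x \<in> cball x0 R" using x(1) R(1) by auto
    then have xI: "x \<in> chart_image c" using R(2) by auto
    have "norm (x - x0) \<le> R / 2" using x(1) by (simp add: dist_norm norm_minus_commute)
    then have "(x - x0) \<bullet> (x - x0) \<le> (R / 2)\<^sup>2" unfolding dot_square_norm by (intro power_mono) auto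
    then have "R\<^sup>2 - (x - x0) \<bullet> (x - x0) \<ge> 3 / 4 * R\<^sup>2" by (simp add: power_divide)
    then have "bump x0 R x \<ge> (3 / 4 * R\<^sup>2)\<^sup>2"
      unfolding bump_def by (intro power_mono max.coboundedI2) auto
    moreover have "(3 / 4 * R\<^sup>2)\<^sup>2 = 9 / 16 * R ^ 4" by (simp add: power2_eq_square power4_eq_xxxx)
    moreover have "9 / 16 * R ^ 4 > R ^ 4 / 2" using R(1) by simp
    ultimately have "bump x0 R x > R ^ 4 / 2" by linarith
    then have \<rho>p: "\<rho> p > R ^ 4 / 2"
      using chart_inv_mem[OF A c xI] snd_chart_inv[OF A c xI] by (simp add: \<rho>_def x(2))
    show "geodesic_ball A g p (R ^ 4 / (2 * C)) \<subseteq> chart_inv c ` ball x0 R"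
    proof
      fix q assume "q \<in> geodesic_ball A g p (R ^ 4 / (2 * C))"
      define S where "S = {L. curve_of_length A g p q L}"
      have "Inf S < R ^ 4 / (2 * C)"
        using \<open>q \<in> _\<close> unfolding geodesic_ball_def riem_dist_def S_def by (rule CollectD)
      moreover obtain L0 where "curve_of_length A g p q L0" using curve_of_length_exists[OF A con] ..
      then have "L0 \<in> S" unfolding S_def by (rule CollectI)
      ultimately obtain L where L: "L \<in> S" "L < R ^ 4 / (2 * C)" using cInf_lessD[of S] by blast
      from L(1) have "curve_of_length A g p q L" unfolding S_def by (rule CollectD)
      note L = this L(2)
      have "\<bar>\<rho> q - \<rho> p\<bar> \<le> C * L"
        unfolding C_def \<rho>_def by (rule bump_curve_bound[OF A g c R m(1) _ L(1)]) (use m(2) in auto)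
      moreover have "C * L < R ^ 4 / 2" using L(2) C by (simp add: field_simps)
      ultimately have "\<rho> q \<noteq> 0" using \<rho>p by auto
      then have q: "q \<in> fst c" "bump x0 R (snd c q) \<noteq> 0" by (auto simp: \<rho>_def split: if_splits)
      then have "snd c q \<in> ball x0 R" using bump_eq_0[OF _ R(1), of "snd c q" x0] by (rule_tac ccontr) simp
      then show "q \<in> chart_inv c ` ball x0 R" by (rule image_eqI[rotated]) (rule chart_inv_snd[OF A c q(1), symmetric])
    qed
  qed
qed

section \<open>Nodal components\<close>

lemma smooth_field_scalar_continuous:
  fixes f :: "'a::t2_space \<Rightarrow> real" and A :: "('a, 'n::finite) chart set"
  assumes A: "smooth_atlas A" and f: "smooth_field A (\<lambda>_. f)"
  shows "continuous_on UNIV f"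
proof -
  have "continuous_on (fst c) f" if c: "c \<in> A" for c
  proof -
    have "continuous_on (chart_image c) (f \<circ> chart_inv c)"
      using f c unfolding smooth_field_def by (blast intro: smooth_on_continuous_on)
    then have "continuous_on (fst c) ((f \<circ> chart_inv c) \<circ> snd c)"
      unfolding chart_image_def by (rule continuous_on_compose[OF continuous_on_snd_chart[OF A c]])
    then show ?thesis
      by (rule continuous_on_eq) (simp add: chart_inv_snd[OF A c])
  qed
  then have "continuous_on (\<Union>c\<in>A. fst c) f"
    using chart_open_domain[OF A] by (intro continuous_on_open_UN) auto
  then show ?thesis using A unfolding smooth_atlas_def by simp
qed

text \<open>Read in the chart, a nodal component inside the disc would be a component of the zero
  set of \<open>u\<close> in the disc, and it is compact as a closed subset of a compact manifold.
  The comparison argument excludes this.\<close>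

lemma nodal_component_not_in_disc:
  fixes A :: "('a::t2_space, 2) chart set"
  assumes M: "closed_manifold A" and data: "schroedinger_data A g V"
    and eig: "normalized_eigenpair A g V l f"
    and c: "c \<in> A" and B: "ball x0 R \<subseteq> chart_image c"
    and lap: "\<And>x. x \<in> ball x0 R \<Longrightarrow> \<theta> < laplacian_sq_dist ((g c \<circ> chart_inv c) x)
        (frechet_derivative (g c \<circ> chart_inv c) (at x) (axis 1 1))
        (frechet_derivative (g c \<circ> chart_inv c) (at x) (axis 2 1)) (x - x0)"
    and h: "\<And>x. x \<in> ball x0 R \<Longrightarrow> \<bar>l - V (chart_inv c x)\<bar> \<le> H"
    and \<kappa>: "\<kappa> > 0" "2 * H \<le> \<kappa> * \<theta>" "\<kappa> * R\<^sup>2 \<le> 1 / 2"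
    and N: "N \<in> components (nodal_set f)"
  shows "\<not> N \<subseteq> chart_inv c ` ball x0 R"
proof
  assume sub: "N \<subseteq> chart_inv c ` ball x0 R"
  have A: "smooth_atlas A" using M by (simp add: closed_manifold_def)
  have g: "riemannian_metric A g" using data by (simp add: schroedinger_data_def)
  define u where "u = f \<circ> chart_inv c"
  define G where "G = g c \<circ> chart_inv c"
  have smG: "smooth_on (chart_image c) G" and smu: "smooth_on (chart_image c) u"
    using g eig c unfolding riemannian_metric_def normalized_eigenpair_def smooth_field_def u_def G_def by blast+
  have Gsym: "transpose (G x) = G x" and Gpd: "v \<noteq> 0 \<Longrightarrow> v \<bullet> (G x *v v) > 0" if "x \<in> chart_image c" for x v
    using g c chart_inv_mem[OF A c that] unfolding riemannian_metric_def G_def by auto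
  have disc: "small_disc G u (\<lambda>x. l - V (chart_inv c x)) x0 R \<theta> H \<kappa>"
    unfolding small_disc_def
  proof (intro conjI ballI allI impI)
    show "smooth_on (ball x0 R) u" using smu B unfolding smooth_on_def by blast
    fix x assume x: "x \<in> ball x0 R"
    then have xI: "x \<in> chart_image c" using B by auto
    show "G differentiable (at x)" by (rule smooth_on_differentiable[OF smG xI])
    show "transpose (G x) = G x" by (rule Gsym[OF xI])
    show "v \<bullet> (G x *v v) > 0" if "v \<noteq> 0" for v by (rule Gpd[OF xI that])
    show "\<bar>l - V (chart_inv c x)\<bar> \<le> H" by (rule h[OF x])
    have det: "det (G y) > 0" if "y \<in> chart_image c" for y
      using pos_def_2(4)[OF Gsym[OF that] Gpd[OF that]] by blast
    show "\<theta> < coord_laplacian G (\<lambda>y. (y - x0) \<bullet> (y - x0)) x"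
      using lap[OF x] coord_laplacian_sq_dist[OF chart_open_image[OF A c] xI det smooth_on_differentiable[OF smG xI], of x0]
      by (simp add: G_def)
    have "schroedinger_op c g V f (chart_inv c x) = l * f (chart_inv c x)"
      using eig c chart_inv_mem[OF A c xI] unfolding normalized_eigenpair_def by blast
    then show "coord_laplacian G u x + (l - V (chart_inv c x)) * u x = 0"
      by (simp add: schroedinger_op_def laplace_beltrami_def snd_chart_inv[OF A c xI] G_def u_def algebra_simps)
  qed (use \<kappa> in auto)
  have "continuous_on UNIV f"
    using eig smooth_field_scalar_continuous[OF A] unfolding normalized_eigenpair_def by blast
  then have "closed (nodal_set f)"
    using continuous_closed_vimage[of "{0}" f] by (simp add: nodal_set_def vimage_def continuous_on_eq_continuous_at)
  then have "closed N" using N closed_components by blast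
  then have cN: "compact N" using M compact_Int_closed[of UNIV N] by (simp add: closed_manifold_def)
  have Nsub: "N \<subseteq> nodal_set f" and Nne: "N \<noteq> {}" and Ncon: "connected N"
    using N in_components_subset in_components_nonempty in_components_connected by blast+
  have Nc: "N \<subseteq> fst c" using sub B chart_inv_mem[OF A c] by blast
  have cont: "continuous_on N (snd c)" using continuous_on_snd_chart[OF A c] Nc continuous_on_subset by blast
  let ?Z = "{x \<in> ball x0 R. u x = 0}"
  have NZ: "snd c ` N \<subseteq> ?Z"
  proof
    fix x assume "x \<in> snd c ` N"
    then obtain p where p: "p \<in> N" "x = snd c p" by auto
    then obtain y where y: "y \<in> ball x0 R" "p = chart_inv c y" using sub by auto
    then have "x = y" using snd_chart_inv[OF A c] B p by auto
    then show "x \<in> ?Z" using y p Nsub by (auto simp: u_def nodal_set_def)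
  qed
  have inv_im: "chart_inv c ` snd c ` N = N"
    using Nc chart_inv_snd[OF A c] by (force simp: image_image)
  \<comment> \<open>Maximality is checked on the manifold: a larger connected part of the zero set
    in the disc would be carried back to a connected part of the nodal set containing
    \<open>N\<close>.\<close>
  have "snd c ` N \<in> components ?Z"
    unfolding in_components_maximal
  proof (intro conjI allI impI NZ)
    show "snd c ` N \<noteq> {}" using Nne by simp
    show "connected (snd c ` N)" by (rule connected_continuous_image[OF cont Ncon])
    fix D assume "D \<noteq> {} \<and> snd c ` N \<subseteq> D \<and> D \<subseteq> ?Z \<and> connected D"
    then have D: "snd c ` N \<subseteq> D" "D \<subseteq> ?Z" "connected D" by auto
    have DI: "D \<subseteq> chart_image c" using D(2) B by blast
    have "connected (chart_inv c ` D)"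
      by (rule connected_continuous_image[OF continuous_on_subset[OF continuous_on_chart_inv[OF A c] DI] D(3)])
    moreover have "chart_inv c ` D \<subseteq> nodal_set f" using D(2) by (auto simp: u_def nodal_set_def)
    moreover have "N \<subseteq> chart_inv c ` D" using inv_im D(1) by blast
    ultimately have "chart_inv c ` D \<subseteq> N"
      using components_maximal[OF N] Nne by blast
    moreover have "snd c ` chart_inv c ` D = D"
      using DI snd_chart_inv[OF A c] by (force simp: image_image)
    ultimately show "D = snd c ` N" using D(1) by blast
  qed
  then have "\<not> compact (snd c ` N)" by (rule no_compact_nodal_component_disc[OF disc])
  then show False using compact_continuous_image[OF cont cN] by blast
qed

text \<open>The disc and the tolerance \<open>e\<close> are fixed by the limit data alone. This
  works because the Laplacian of the squared distance involves the metric only up to first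
  derivatives, and the potential and the eigenvalue enter only through the bound on their
  difference.\<close>

lemma stable_disc:
  fixes A :: "('a::t2_space, 2) chart set" and lam0 :: real
  assumes M: "closed_manifold A" and data: "schroedinger_data A g0 V0"
    and c: "c \<in> A" and p0: "p0 \<in> fst c"
  obtains R e where "R > 0" "e > 0" "cball (snd c p0) R \<subseteq> chart_image c"
    "\<And>g V l f N. \<lbrakk>schroedinger_data A g V; normalized_eigenpair A g V l f;
       \<forall>vs\<in>{[], [axis 1 1], [axis 2 1]}. \<forall>x\<in>cball (snd c p0) R.
         dist (iter_deriv vs (g c \<circ> chart_inv c) x) (iter_deriv vs (g0 c \<circ> chart_inv c) x) < e;
       \<forall>p. dist (V p) (V0 p) < 1; dist l lam0 < 1; N \<in> components (nodal_set f)\<rbrakk>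
      \<Longrightarrow> \<not> N \<subseteq> chart_inv c ` ball (snd c p0) R"
proof -
  have A: "smooth_atlas A" using M by (simp add: closed_manifold_def)
  have g0: "riemannian_metric A g0" using data by (simp add: schroedinger_data_def)
  define x0 where "x0 = snd c p0"
  have x0I: "x0 \<in> chart_image c" unfolding x0_def by (rule snd_mem_chart_image[OF A c p0])
  have ix0: "chart_inv c x0 = p0" unfolding x0_def by (rule chart_inv_snd[OF A c p0])
  define G where "G = g0 c \<circ> chart_inv c"
  have smG: "smooth_on (chart_image c) G" and smV: "smooth_on (chart_image c) (V0 \<circ> chart_inv c)"
    using g0 data c unfolding riemannian_metric_def schroedinger_data_def smooth_field_def G_def by blast+
  have "transpose (G x0) = G x0" "\<And>v. v \<noteq> 0 \<Longrightarrow> v \<bullet> (G x0 *v v) > 0"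
    using g0 c p0 unfolding riemannian_metric_def G_def by (auto simp: ix0)
  note p = pos_def_2[OF this]
  have "G x0 $ 1 $ 1 + G x0 $ 2 $ 2 > 0" using p by simp
  then obtain e \<theta> where e: "e > 0" "\<theta> > 0"
    "\<And>P' Q1' Q2' d. \<lbrakk>norm (P' - G x0) < e; norm (Q1' - iter_deriv [axis 1 1] G x0) < e;
        norm (Q2' - iter_deriv [axis 2 1] G x0) < e; norm d < e\<rbrakk> \<Longrightarrow> \<theta> < laplacian_sq_dist P' Q1' Q2' d"
    using laplacian_sq_dist_pos_nhds[OF p(4), where ?Q1.0="iter_deriv [axis 1 1] G x0" and ?Q2.0="iter_deriv [axis 2 1] G x0"]
    by metis
  \<comment> \<open>The three units pay for \<open>l\<close> against \<open>lam0\<close>, for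
    \<open>V\<close> against \<open>V0\<close>, and for the oscillation of \<open>V0\<close> on the
    disc.\<close>
  define H where "H = \<bar>lam0\<bar> + \<bar>V0 p0\<bar> + 3"
  have H: "H > 0" by (simp add: H_def)
  define \<kappa> where "\<kappa> = 2 * H / \<theta>"
  have \<kappa>: "\<kappa> > 0" "2 * H \<le> \<kappa> * \<theta>" using H e(2) by (auto simp: \<kappa>_def)
  have ev: "\<forall>\<^sub>F x in nhds x0. dist (F x) (F x0) < r" if "F differentiable (at x0)" "r > 0"
    for F :: "real^2 \<Rightarrow> 'z::real_normed_vector" and r
  proof -
    have "(F \<longlongrightarrow> F x0) (at x0)"
      using differentiable_imp_continuous_within[OF that(1)] by (simp add: isCont_def)
    then show ?thesis using that(2) by (simp add: eventually_nhds_conv_at tendsto_iff)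
  qed
  have dG: "iter_deriv vs G differentiable (at x0)" for vs using smG x0I unfolding smooth_on_def by blast
  \<comment> \<open>Half of \<open>e\<close> is spent on the variation of the limit metric over the
    disc; the other half is left for the distance of the perturbed metric from it.\<close>
  have "\<forall>\<^sub>F x in nhds x0. (dist (iter_deriv [] G x) (iter_deriv [] G x0) < e / 2 \<and>
      dist (iter_deriv [axis 1 1] G x) (iter_deriv [axis 1 1] G x0) < e / 2 \<and>
      dist (iter_deriv [axis 2 1] G x) (iter_deriv [axis 2 1] G x0) < e / 2) \<and>
      dist ((V0 \<circ> chart_inv c) x) ((V0 \<circ> chart_inv c) x0) < 1 \<and> dist x x0 < e \<and> x \<in> chart_image c"
    using e(1) by (intro eventually_conj ev dG smooth_on_differentiable[OF smV x0I] differentiable_ident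
        eventually_nhds_in_open chart_open_image[OF A c] x0I) auto
  then obtain d where d: "d > 0" "\<And>x. dist x x0 < d \<Longrightarrow> (dist (iter_deriv [] G x) (iter_deriv [] G x0) < e / 2 \<and>
      dist (iter_deriv [axis 1 1] G x) (iter_deriv [axis 1 1] G x0) < e / 2 \<and>
      dist (iter_deriv [axis 2 1] G x) (iter_deriv [axis 2 1] G x0) < e / 2) \<and>
      dist ((V0 \<circ> chart_inv c) x) ((V0 \<circ> chart_inv c) x0) < 1 \<and> dist x x0 < e \<and> x \<in> chart_image c"
    unfolding eventually_nhds_metric by blast
  \<comment> \<open>The first bound keeps the closed disc inside the continuity radius
    \<open>d\<close>; the other two give
    \<open>\<kappa> * R^2 \<le> \<kappa> * R \<le> 1 / 2\<close>.\<close>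
  define R where "R = min (d / 2) (min 1 (1 / (2 * \<kappa>)))"
  have R: "R > 0" "R < d" "R \<le> 1" "R \<le> 1 / (2 * \<kappa>)" using d(1) \<kappa>(1) by (auto simp: R_def)
  have "\<kappa> * R\<^sup>2 \<le> \<kappa> * R" using R \<kappa>(1) by (simp add: power2_eq_square)
  also have "\<dots> \<le> 1 / 2" using R(4) \<kappa>(1) by (simp add: field_simps)
  finally have \<kappa>R: "\<kappa> * R\<^sup>2 \<le> 1 / 2" .
  have inR: "dist x x0 < d" if "x \<in> cball x0 R" for x using that R(2) by (simp add: dist_commute)
  have cb: "cball x0 R \<subseteq> chart_image c" using d(2) inR by blast
  show thesis
  proof (rule that[of R "e / 2"])
    show "R > 0" "e / 2 > 0" using R e by auto
    show "cball (snd c p0) R \<subseteq> chart_image c" using cb by (simp add: x0_def)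
    fix g V l f N
    assume sd: "schroedinger_data A g V" and ne: "normalized_eigenpair A g V l f"
      and close: "\<forall>vs\<in>{[], [axis 1 1], [axis 2 1]}. \<forall>x\<in>cball (snd c p0) R.
         dist (iter_deriv vs (g c \<circ> chart_inv c) x) (iter_deriv vs (g0 c \<circ> chart_inv c) x) < e / 2"
      and V: "\<forall>p. dist (V p) (V0 p) < 1" and l: "dist l lam0 < 1" and N: "N \<in> components (nodal_set f)"
    have "\<not> N \<subseteq> chart_inv c ` ball x0 R"
    proof (rule nodal_component_not_in_disc[OF M sd ne c _ _ _ \<kappa> \<kappa>R N])
      show "ball x0 R \<subseteq> chart_image c" using cb ball_subset_cball by blast
      fix x assume "x \<in> ball x0 R"
      then have x: "x \<in> cball x0 R" by auto
      note dx = d(2)[OF inR[OF x]]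
      have dn: "norm (iter_deriv vs (g c \<circ> chart_inv c) x - iter_deriv vs G x0) < e"
        if "vs \<in> {[], [axis 1 1], [axis 2 1]}" for vs
      proof -
        have "dist (iter_deriv vs (g c \<circ> chart_inv c) x) (iter_deriv vs G x) < e / 2"
          using bspec[OF bspec[OF close that], of x] x by (simp add: G_def x0_def)
        moreover have "dist (iter_deriv vs G x) (iter_deriv vs G x0) < e / 2" using dx that by auto
        ultimately show ?thesis
          using dist_triangle[of "iter_deriv vs (g c \<circ> chart_inv c) x" "iter_deriv vs G x0" "iter_deriv vs G x"]
          unfolding dist_norm[symmetric] by linarith
      qed
      show "\<theta> < laplacian_sq_dist ((g c \<circ> chart_inv c) x)
        (frechet_derivative (g c \<circ> chart_inv c) (at x) (axis 1 1))
        (frechet_derivative (g c \<circ> chart_inv c) (at x) (axis 2 1)) (x - x0)"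
        using dn[of "[]"] dn[of "[axis 1 1]"] dn[of "[axis 2 1]"] dx
        by (intro e(3)) (auto simp: dist_norm)
      have "\<bar>V0 (chart_inv c x) - V0 p0\<bar> < 1" using dx by (simp add: dist_real_def ix0)
      moreover have "\<bar>V (chart_inv c x) - V0 (chart_inv c x)\<bar> < 1" using V by (simp add: dist_real_def)
      moreover have "\<bar>l - lam0\<bar> < 1" using l by (simp add: dist_real_def)
      ultimately show "\<bar>l - V (chart_inv c x)\<bar> \<le> H" unfolding H_def by linarith
    qed
    then show "\<not> N \<subseteq> chart_inv c ` ball (snd c p0) R" by (simp add: x0_def)
  qed
qed



theorem theorem4p6:
  fixes A :: "('a::t2_space, 2) chart set"
    and g0 :: "('a, 2) metric" and V0 \<phi>0 :: "'a \<Rightarrow> real" and lam0 :: real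
  assumes "closed_manifold A"
    and "schroedinger_data A g0 V0"
    and "normalized_eigenpair A g0 V0 lam0 \<phi>0"
    and "lam0 > 0"
  shows "\<exists>cs>0. \<forall>(I :: real set) (g :: real \<Rightarrow> ('a, 2) metric) (V :: real \<Rightarrow> 'a \<Rightarrow> real)
            (lam :: real \<Rightarrow> real) (\<phi> :: real \<Rightarrow> 'a \<Rightarrow> real).
      parameter_interval I \<longrightarrow>
      smooth_schroedinger_family A I g V \<longrightarrow>
      eigenbranch A I g V lam \<phi> \<longrightarrow>
      (\<forall>c\<in>A. \<forall>p\<in>fst c. g 0 c p = g0 c p) \<longrightarrow> V 0 = V0 \<longrightarrow> lam 0 = lam0 \<longrightarrow> \<phi> 0 = \<phi>0 \<longrightarrow>
      Ck_tendsto A 2 g g0 \<longrightarrow>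
      uniform_limit UNIV V V0 (at 0) \<longrightarrow>
      (lam \<longlongrightarrow> lam0) (at 0) \<longrightarrow>
      (\<forall>k. Ck_tendsto A k (\<lambda>t _. \<phi> t) (\<lambda>_. \<phi>0)) \<longrightarrow>
      (\<exists>ts>0. \<forall>t. \<bar>t\<bar> < ts \<longrightarrow> t \<in> I \<and>
         (\<forall>N\<in>components (nodal_set (\<phi> t)). \<forall>p.
            \<not> N \<subseteq> geodesic_ball A g0 p (cs * lam0 powr (- 1 / 2))))"
proof -
  define hyps where "hyps I g V lam \<phi> \<longleftrightarrow> parameter_interval I \<and> smooth_schroedinger_family A I g V \<and>
      eigenbranch A I g V lam \<phi> \<and> \<phi> 0 = \<phi>0 \<and> Ck_tendsto A 2 g g0 \<and>
      uniform_limit UNIV V V0 (at 0) \<and> (lam \<longlongrightarrow> lam0) (at 0)"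
    for I :: "real set" and g :: "real \<Rightarrow> ('a, 2) metric" and V :: "real \<Rightarrow> 'a \<Rightarrow> real"
      and lam :: "real \<Rightarrow> real" and \<phi> :: "real \<Rightarrow> 'a \<Rightarrow> real"
  have A: "smooth_atlas A" and con: "connected (UNIV :: 'a set)" and comp: "compact (UNIV :: 'a set)"
    using assms(1) by (auto simp: closed_manifold_def)
  have g0: "riemannian_metric A g0" using assms(2) by (simp add: schroedinger_data_def)
  \<comment> \<open>The radius \<open>\<delta>\<close> must be chosen before the family, for all
    centres in \<open>U\<close> at once; only the threshold \<open>ts\<close> may depend on the
    family. This order of quantifiers survives passing to a finite cover.\<close>
  define Q where "Q U \<delta> \<longleftrightarrow> (\<forall>I g V lam \<phi>. hyps I g V lam \<phi> \<longrightarrow>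
     (\<exists>ts>0. \<forall>t. \<bar>t\<bar> < ts \<longrightarrow> t \<in> I \<and>
       (\<forall>N\<in>components (nodal_set (\<phi> t)). \<forall>p\<in>U. \<not> N \<subseteq> geodesic_ball A g0 p \<delta>)))" for U \<delta>
  have local: "\<exists>U \<delta>. open U \<and> p0 \<in> U \<and> \<delta> > 0 \<and> Q U \<delta>" for p0
  proof -
    obtain c where c: "c \<in> A" "p0 \<in> fst c" using chart_exists[OF A] by blast
    let ?x0 = "snd c p0"
    show ?thesis
    proof (rule stable_disc[OF assms(1,2) c, of lam0])
      fix R e assume R: "R > 0" "e > 0" "cball ?x0 R \<subseteq> chart_image c"
        and stable: "\<And>g V l f N. \<lbrakk>schroedinger_data A g V; normalized_eigenpair A g V l f;
         \<forall>vs\<in>{[], [axis 1 1], [axis 2 1]}. \<forall>x\<in>cball ?x0 R.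
           dist (iter_deriv vs (g c \<circ> chart_inv c) x) (iter_deriv vs (g0 c \<circ> chart_inv c) x) < e;
         \<forall>p. dist (V p) (V0 p) < 1; dist l lam0 < 1; N \<in> components (nodal_set f)\<rbrakk>
        \<Longrightarrow> \<not> N \<subseteq> chart_inv c ` ball ?x0 R"
      obtain \<delta> where \<delta>: "\<delta> > 0"
        "\<And>p. p \<in> chart_inv c ` ball ?x0 (R / 2) \<Longrightarrow> geodesic_ball A g0 p \<delta> \<subseteq> chart_inv c ` ball ?x0 R"
        using geodesic_balls_in_coordinate_ball[OF A con g0 c(1) R(1,3)] by metis
      define U where "U = chart_inv c ` ball ?x0 (R / 2)"
      have "ball ?x0 (R / 2) \<subseteq> cball ?x0 R" using R(1) by auto
      then have "open U"
        unfolding U_def by (intro chart_inv_open_image[OF A c(1) open_ball]) (use R(3) in blast)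
      moreover have "p0 \<in> U"
        unfolding U_def by (rule image_eqI[of _ _ ?x0]) (use R(1) chart_inv_snd[OF A c] in auto)
      moreover have "Q U \<delta>"
        unfolding Q_def
      proof (intro allI impI)
        fix I g V lam \<phi> assume h: "hyps I g V lam \<phi>"
        then have I: "open I" "0 \<in> I" by (auto simp: hyps_def parameter_interval_def)
        have ul: "\<forall>\<^sub>F t in at 0. \<forall>x\<in>cball ?x0 R. dist (iter_deriv vs (g t c \<circ> chart_inv c) x)
            (iter_deriv vs (g0 c \<circ> chart_inv c) x) < e" if "length vs \<le> 2" for vs
        proof -
          have "Ck_tendsto A 2 g g0" using h by (simp add: hyps_def)
          from uniform_limitD[OF this[unfolded Ck_tendsto_def, rule_format,
              OF c(1) conjI[OF compact_cball R(3)] that] R(2)]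
          show ?thesis .
        qed
        have "\<forall>\<^sub>F t in at 0. t \<in> I \<and> (\<forall>p\<in>UNIV. dist (V t p) (V0 p) < 1) \<and> dist (lam t) lam0 < 1 \<and>
           (\<forall>vs\<in>{[], [axis 1 1], [axis 2 1]}. \<forall>x\<in>cball ?x0 R. dist (iter_deriv vs (g t c \<circ> chart_inv c) x)
            (iter_deriv vs (g0 c \<circ> chart_inv c) x) < e)"
        proof (intro eventually_conj)
          show "\<forall>\<^sub>F t in at 0. t \<in> I" using I by (rule eventually_at_in_open')
          show "\<forall>\<^sub>F t in at 0. \<forall>p\<in>UNIV. dist (V t p) (V0 p) < 1"
            using h unfolding hyps_def by (intro uniform_limitD) auto
          show "\<forall>\<^sub>F t in at 0. dist (lam t) lam0 < 1"
            using h unfolding hyps_def by (intro tendstoD) auto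
          show "\<forall>\<^sub>F t in at 0. \<forall>vs\<in>{[], [axis 1 1], [axis 2 1]}. \<forall>x\<in>cball ?x0 R.
             dist (iter_deriv vs (g t c \<circ> chart_inv c) x) (iter_deriv vs (g0 c \<circ> chart_inv c) x) < e"
          proof (rule eventually_ball_finite; (intro ballI)?)
            fix vs :: "(real^2) list" assume "vs \<in> {[], [axis 1 1], [axis 2 1]}"
            then have "length vs \<le> 2" by auto
            then show "\<forall>\<^sub>F t in at 0. \<forall>x\<in>cball ?x0 R.
               dist (iter_deriv vs (g t c \<circ> chart_inv c) x) (iter_deriv vs (g0 c \<circ> chart_inv c) x) < e"
              by (rule ul)
          qed simp
        qed
        then obtain ts where ts: "ts > 0" and near: "\<And>t. t \<noteq> 0 \<Longrightarrow> \<bar>t\<bar> < ts \<Longrightarrow> t \<in> I \<and>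
           (\<forall>p\<in>UNIV. dist (V t p) (V0 p) < 1) \<and> dist (lam t) lam0 < 1 \<and>
           (\<forall>vs\<in>{[], [axis 1 1], [axis 2 1]}. \<forall>x\<in>cball ?x0 R. dist (iter_deriv vs (g t c \<circ> chart_inv c) x)
            (iter_deriv vs (g0 c \<circ> chart_inv c) x) < e)"
          unfolding eventually_at dist_real_def by auto
        have "t \<in> I \<and> (\<forall>N\<in>components (nodal_set (\<phi> t)). \<not> N \<subseteq> chart_inv c ` ball ?x0 R)" if t: "\<bar>t\<bar> < ts" for t
        \<comment> \<open>The filter \<open>at 0\<close> says nothing about \<open>t = 0\<close>
          itself. There \<open>\<phi> 0 = \<phi>0\<close>, and the limit data are trivially within
          every tolerance of themselves.\<close>
        proof (cases "t = 0")
          case True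
          have "\<phi> 0 = \<phi>0" using h by (simp add: hyps_def)
          then show ?thesis
            unfolding True using I(2) stable[OF assms(2,3)] R(2) by auto
        next
          case False
          note nt = near[OF False t]
          have "schroedinger_data A (g t) (V t)" "normalized_eigenpair A (g t) (V t) (lam t) (\<phi> t)"
            using h nt unfolding hyps_def smooth_schroedinger_family_def eigenbranch_def by auto
          from stable[OF this] nt show ?thesis by blast
        qed
        then show "\<exists>ts>0. \<forall>t. \<bar>t\<bar> < ts \<longrightarrow> t \<in> I \<and>
            (\<forall>N\<in>components (nodal_set (\<phi> t)). \<forall>p\<in>U. \<not> N \<subseteq> geodesic_ball A g0 p \<delta>)"
          using ts \<delta>(2) unfolding U_def by (meson order_trans)
      qed
      ultimately show ?thesis using \<delta>(1) by blast
    qed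
  qed
  then obtain U \<delta> where U: "\<And>p. open (U p)" "\<And>p. p \<in> U p" "\<And>p. \<delta> p > 0" "\<And>p. Q (U p) (\<delta> p)"
    by metis
  have cov: "UNIV \<subseteq> (\<Union>p\<in>UNIV. U p)" using U(2) by auto
  obtain F where "F \<subseteq> UNIV" and F: "finite F" "UNIV \<subseteq> (\<Union>p\<in>F. U p)"
    by (rule compactE_image[OF comp _ cov]) (rule U(1))
  have Fne: "F \<noteq> {}" using F(2) by auto
  \<comment> \<open>The smallest of finitely many radii works for every centre, as geodesic balls
    grow with the radius.\<close>
  define r where "r = Min (\<delta> ` F)"
  have r: "r > 0" "\<And>p. p \<in> F \<Longrightarrow> r \<le> \<delta> p" using F(1) Fne U(3) by (auto simp: r_def)
  \<comment> \<open>With \<open>cs\<close> equal to \<open>r\<close> times the root of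
    \<open>lam0\<close>, the radius in the conclusion is exactly \<open>r\<close>.\<close>
  have rad: "r * lam0 powr (1 / 2) * lam0 powr (- 1 / 2) = r"
    using assms(4) by (simp add: mult.assoc flip: powr_add)
  have fin: "\<exists>ts>0. \<forall>t. \<bar>t\<bar> < ts \<longrightarrow> t \<in> I \<and>
         (\<forall>N\<in>components (nodal_set (\<phi> t)). \<forall>p. \<not> N \<subseteq> geodesic_ball A g0 p r)"
    if h: "hyps I g V lam \<phi>" for I g V lam \<phi>
  proof -
    have "\<forall>q\<in>F. \<exists>ts>0. \<forall>t. \<bar>t\<bar> < ts \<longrightarrow> t \<in> I \<and>
       (\<forall>N\<in>components (nodal_set (\<phi> t)). \<forall>p\<in>U q. \<not> N \<subseteq> geodesic_ball A g0 p (\<delta> q))"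
      using U(4) h unfolding Q_def by blast
    then obtain ts where ts: "\<And>q. q \<in> F \<Longrightarrow> ts q > 0" "\<And>q t. q \<in> F \<Longrightarrow> \<bar>t\<bar> < ts q \<Longrightarrow> t \<in> I \<and>
       (\<forall>N\<in>components (nodal_set (\<phi> t)). \<forall>p\<in>U q. \<not> N \<subseteq> geodesic_ball A g0 p (\<delta> q))"
      by metis
    define T where "T = Min (ts ` F)"
    have T: "T > 0" "\<And>q. q \<in> F \<Longrightarrow> T \<le> ts q" using F(1) Fne ts(1) by (auto simp: T_def)
    have "t \<in> I \<and> (\<forall>N\<in>components (nodal_set (\<phi> t)). \<forall>p. \<not> N \<subseteq> geodesic_ball A g0 p r)" if t: "\<bar>t\<bar> < T" for t
    proof (intro conjI ballI allI)
      show "t \<in> I" using Fne ts(2) T(2) t by fastforce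
      fix N p assume N: "N \<in> components (nodal_set (\<phi> t))"
      obtain q where q: "q \<in> F" "p \<in> U q" using F(2) by auto
      have "\<not> N \<subseteq> geodesic_ball A g0 p (\<delta> q)" using ts(2)[OF q(1), of t] T(2)[OF q(1)] t q(2) N by auto
      moreover have "geodesic_ball A g0 p r \<subseteq> geodesic_ball A g0 p (\<delta> q)"
        using r(2)[OF q(1)] by (auto simp: geodesic_ball_def)
      ultimately show "\<not> N \<subseteq> geodesic_ball A g0 p r" by blast
    qed
    then show ?thesis using T(1) by blast
  qed
  show ?thesis
  proof (rule exI[of _ "r * lam0 powr (1 / 2)"], intro conjI allI impI)
    show "0 < r * lam0 powr (1 / 2)" using r(1) assms(4) by simp
  qed (unfold rad, rule fin, auto simp: hyps_def)
qed

end
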